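(* Let $R$ be a finite chain ring of length $2$ with residue field $\mathbb{F}_q$, and let $n=2q+t$ with $0\le t\le q-2$. Then $$\mathrm{m}_n(R)\ge\begin{cases} q(q+1)n-q^3+2q^2-4q-2t & \text{if } t\le q-5,\\ q(q+1)n-q^3+2q^2-8q+16 & \text{if } t=q-4,\\ q(q+1)n-q^3+q^2-2q & \text{if } t=q-3,\\ q(q+1)n-q^3 & \text{if } t=q-2.\end{cases}$$ Equivalently, there exist projective $\bigl(q^3+(t+4)q^2+(t-4)q-2t,\,2q+t\bigr)$-arcs for $0\le t\le q-5$, and (whenever the respective $t=q-4,q-3,q-2$ is nonnegative) projective $(2q^3+q^2-12q+16,\,3q-4)$-, $(2q^3+q^2-5q,\,3q-3)$- and $(2q^3+q^2-2q,\,3q-2)$-arcs in $\mathrm{PHG}(2,R)$.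
   Context: Throughout, $R$ is a finite chain ring of nilpotency index (length) $2$, i.e. a finite local ring with radical $\mathrm{rad}R\neq 0$, $(\mathrm{rad}R)^2=0$, whose one-sided ideals form the chain $R\supsetneq\mathrm{rad}R\supsetneq 0$, with residue field $R/\mathrm{rad}R\cong\mathbb{F}_q$ ($q$ a prime power); then $|R|=q^2$. The projective Hjelmslev plane $\mathrm{PHG}(2,R)$ is the incidence structure whose points are the free rank-$1$ submodules of the right module $R_R^3$, whose lines are the free rank-$2$ submodules of $R_R^3$, with incidence given by inclusion; it has $q^4+q^3+q^2$ points and each line contains $q^2+q$ points. A $(k,n)$-arc is a map $\mathcal{K}$ from the point set to $\mathbb{N}_0$ with $\sum_x\mathcal{K}(x)=k$ and $\sum_{x\in L}\mathcal{K}(x)\le n$ for every line $L$; it is projective if $\mathcal{K}$ takes only values in $\{0,1\}$ (i.e. it is a set of $k$ points meeting every line in at most $n$ points). For $0\le n\le q^2+q$, $\mathrm{m}_n(R)$ denotes the largest $k$ such that a projective $(k,n)$-arc exists in $\mathrm{PHG}(2,R)$. *)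

theory Defs
  imports Main
begin

type_synonym 'r vec3 = "'r \<times> 'r \<times> 'r"

definition vadd :: "'r::ring_1 vec3 \<Rightarrow> 'r vec3 \<Rightarrow> 'r vec3" where
  "vadd x y = (fst x + fst y, fst (snd x) + fst (snd y), snd (snd x) + snd (snd y))"

definition vsmul :: "'r::ring_1 vec3 \<Rightarrow> 'r \<Rightarrow> 'r vec3" where
  "vsmul x a = (fst x * a, fst (snd x) * a, snd (snd x) * a)"

definition vzero :: "'r::ring_1 vec3" where
  "vzero = (0, 0, 0)"

definition right_ideal :: "'r::ring_1 set \<Rightarrow> bool" where
  "right_ideal I \<longleftrightarrow> 0 \<in> I \<and> (\<forall>x\<in>I. \<forall>y\<in>I. x + y \<in> I) \<and> (\<forall>x\<in>I. - x \<in> I)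
     \<and> (\<forall>x\<in>I. \<forall>r. x * r \<in> I)"

definition left_ideal :: "'r::ring_1 set \<Rightarrow> bool" where
  "left_ideal I \<longleftrightarrow> 0 \<in> I \<and> (\<forall>x\<in>I. \<forall>y\<in>I. x + y \<in> I) \<and> (\<forall>x\<in>I. - x \<in> I)
     \<and> (\<forall>x\<in>I. \<forall>r. r * x \<in> I)"

definition chain_ring2 :: "'r::{ring_1,finite} set \<Rightarrow> bool" where
  "chain_ring2 N \<longleftrightarrow> N \<noteq> UNIV \<and> N \<noteq> {0}
     \<and> {I. right_ideal I} = {UNIV, N, {0}}
     \<and> {I. left_ideal I} = {UNIV, N, {0}}
     \<and> (\<forall>a\<in>N. \<forall>b\<in>N. a * b = 0)"

text \<open>Free rank-1 submodules of R_R^3 (points of PHG(2,R)): x R with x a basis.\<close>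
definition hpoints :: "('r::{ring_1,finite} vec3) set set" where
  "hpoints = {M. \<exists>x. M = {vsmul x a | a. True} \<and> (\<forall>a. vsmul x a = vzero \<longrightarrow> a = 0)}"

text \<open>Free rank-2 submodules of R_R^3 (lines of PHG(2,R)): x R + y R with basis x, y.\<close>
definition hlines :: "('r::{ring_1,finite} vec3) set set" where
  "hlines = {M. \<exists>x y. M = {vadd (vsmul x a) (vsmul y b) | a b. True}
       \<and> (\<forall>a b. vadd (vsmul x a) (vsmul y b) = vzero \<longrightarrow> a = 0 \<and> b = 0)}"

definition proj_arc :: "('r::{ring_1,finite} vec3) set set \<Rightarrow> nat \<Rightarrow> nat \<Rightarrow> bool" where
  "proj_arc K k n \<longleftrightarrow> K \<subseteq> hpoints \<and> card K = k
     \<and> (\<forall>L\<in>hlines. card {P\<in>K. P \<subseteq> L} \<le> n)"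

definition m_arc :: "'r::{ring_1,finite} itself \<Rightarrow> nat \<Rightarrow> nat" where
  "m_arc TYPE('r) n = Max {k. \<exists>K::('r vec3) set set. proj_arc K k n}"

end

theory Submission
  imports Defs "HOL-Computational_Algebra.Polynomial" "HOL-Algebra.Group_Action" "HOL-Algebra.Ring"
begin

text \<open>
  Normalizing a coordinate to 1, the points are the affine ones \<open>(1, x, y)\<close>, the infinite ones
  \<open>(\<nu>, 1, y)\<close> in \<open>q\<close> neighbour classes indexed by slopes, and the points \<open>(\<nu>, \<mu>, 1)\<close> of the
  vertical infinite class, where \<open>\<nu>, \<mu> \<in> N\<close>. A line meets a neighbour class in the empty set or in a
  segment, a line of the affine plane of order \<open>q\<close> formed by the class.

  The arc consists of columns of affine classes. A class in a double column contains two parallel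
  segments whose slope is the label of the column; a class in a conic column contains one vertical
  segment. A sloped line meets a double class in 2 points and a conic class in 1 point, except that in
  the unique column with its own slope it may gain \<open>q - 2\<close> further points. A vertical line has at most
  \<open>2 q\<close> affine points: two in each class of a double column, while in a conic column the segments
  form a dual conic, so at most two of them lie on the line. This is the only step that needs the
  residue division ring to be commutative (Wedderburn's theorem). The columns are chosen such that a
  sloped line whose slope labels no double column has \<open>q + t + 2\<close> affine points. Its remaining
  \<open>q - 2\<close> points are used by \<open>q - 2\<close> infinite segments in the classes of up to two such slopes; the
  remaining \<open>t\<close> points of the vertical lines are used by a grid in the vertical infinite class.
\<close>

section \<open>Values of cyclotomic polynomials\<close>

text \<open>The minimality condition encodes exact order \<open>n\<close>. For \<open>n = 0\<close>
  the set is the whole complex plane, hence the positivity assumptions on \<open>n\<close>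
  below.\<close>

definition primitive_roots :: "nat \<Rightarrow> complex set" where
  "primitive_roots n = {z. z ^ n = 1 \<and> (\<forall>d. 0 < d \<and> d < n \<longrightarrow> z ^ d \<noteq> 1)}"

definition cyclotomic :: "nat \<Rightarrow> complex poly" where
  "cyclotomic n = (\<Prod>z\<in>primitive_roots n. [:- z, 1:])"

definition int_coeffs :: "complex poly \<Rightarrow> bool" where
  "int_coeffs p \<longleftrightarrow> (\<forall>i. coeff p i \<in> \<int>)"

lemma int_coeffs_mult: "int_coeffs p \<Longrightarrow> int_coeffs r \<Longrightarrow> int_coeffs (p * r)"
  unfolding int_coeffs_def coeff_mult by (intro allI Ints_sum Ints_mult) auto

lemma int_coeffs_prod: "(\<And>x. x \<in> A \<Longrightarrow> int_coeffs (f x)) \<Longrightarrow> int_coeffs (prod f A)"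
proof (induction A rule: infinite_finite_induct)
  case (insert x F)
  then show ?case by (simp add: int_coeffs_mult)
qed (auto simp: int_coeffs_def coeff_1)

lemma poly_int_coeffs: "int_coeffs p \<Longrightarrow> x \<in> \<int> \<Longrightarrow> poly p x \<in> \<int>"
  unfolding int_coeffs_def poly_altdef by (intro Ints_sum Ints_mult Ints_power) auto

text \<open>Let \<open>i\<close> be the largest index of a non-integral coefficient of
  \<open>p\<close>. In the coefficient of \<open>p * m\<close> at \<open>i + degree m\<close>, the
  index \<open>i\<close> contributes exactly \<open>coeff p i\<close>, larger indices contribute
  integers, and smaller ones meet coefficients of \<open>m\<close> beyond its degree.\<close>

lemma int_coeffs_monic_cofactor:
  assumes "int_coeffs (p * m)" "int_coeffs m" "lead_coeff m = 1"
  shows "int_coeffs p"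
proof (rule ccontr)
  assume "\<not> int_coeffs p"
  define S where "S = {i. coeff p i \<notin> \<int>}"
  have ne: "S \<noteq> {}" using \<open>\<not> int_coeffs p\<close> by (auto simp: S_def int_coeffs_def)
  have "S \<subseteq> {..degree p}"
    unfolding S_def by (metis (mono_tags, lifting) Ints_0 atMost_iff le_degree mem_Collect_eq subsetI)
  then have fin: "finite S" using finite_subset by blast
  define i where "i = Max S"
  have iS: "coeff p i \<notin> \<int>" using Max_in[OF fin ne] by (auto simp: i_def S_def)
  have big: "coeff p j \<in> \<int>" if "j > i" for j
    using Max_ge[OF fin, of j] that by (fastforce simp: i_def S_def)
  let ?k = "i + degree m"
  have "coeff (p * m) ?k = (\<Sum>j\<le>?k. coeff p j * coeff m (?k - j))" by (rule coeff_mult)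
  also have "\<dots> = coeff p i * coeff m (?k - i) + (\<Sum>j\<in>{..?k} - {i}. coeff p j * coeff m (?k - j))"
    by (subst sum.remove[of _ i]) auto
  finally have "coeff p i = coeff (p * m) ?k - (\<Sum>j\<in>{..?k} - {i}. coeff p j * coeff m (?k - j))"
    using assms(3) by simp
  moreover have "coeff p j * coeff m (?k - j) \<in> \<int>" if "j \<noteq> i" for j
  proof (cases "j > i")
    case True
    then show ?thesis using big assms(2) by (auto simp: int_coeffs_def)
  next
    case False
    then have "degree m < ?k - j" using that by simp
    then show ?thesis by (simp add: coeff_eq_0)
  qed
  ultimately have "coeff p i \<in> \<int>"
    using assms(1) by (auto simp: int_coeffs_def intro!: Ints_diff Ints_sum)
  with iS show False by blast
qed

section \<open>Roots of unity and the factorization of \<open>monom 1 n - 1\<close>\<close>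

lemma finite_roots_unity: "n > 0 \<Longrightarrow> finite {z::complex. z ^ n = 1}"
  using card_roots_unity_eq[of n] card_ge_0_finite by fastforce

lemma primitive_roots_subset: "primitive_roots n \<subseteq> {z. z ^ n = 1}"
  by (auto simp: primitive_roots_def)

lemma finite_primitive_roots: "n > 0 \<Longrightarrow> finite (primitive_roots n)"
  using finite_subset[OF primitive_roots_subset finite_roots_unity] .

lemma primitive_roots_dvd:
  assumes "z \<in> primitive_roots n" "z ^ m = 1" "n > 0"
  shows "n dvd m"
proof -
  have "z ^ m = (z ^ n) ^ (m div n) * z ^ (m mod n)"
    by (simp flip: power_mult power_add)
  then have "z ^ (m mod n) = 1" using assms by (simp add: primitive_roots_def)
  moreover have "m mod n < n" using assms(3) by simp
  ultimately have "m mod n = 0" using assms(1) by (auto simp: primitive_roots_def)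
  then show ?thesis by auto
qed

lemma primitive_roots_disjoint:
  assumes "m > 0" "n > 0" "m \<noteq> n" shows "primitive_roots m \<inter> primitive_roots n = {}"
proof (rule ccontr)
  assume "\<not> ?thesis"
  then obtain z where "z \<in> primitive_roots m" "z \<in> primitive_roots n" by blast
  then have "m dvd n" "n dvd m"
    using assms primitive_roots_dvd[of z] by (auto simp: primitive_roots_def)
  with assms show False using dvd_antisym by blast
qed

lemma roots_unity_eq_Union_primitive_roots:
  assumes "n > 0" shows "{z. z ^ n = 1} = (\<Union>d\<in>{d. d dvd n}. primitive_roots d)"
proof (intro equalityI subsetI)
  fix z :: complex assume z: "z \<in> {z. z ^ n = 1}"
  define d where "d = (LEAST d. d > 0 \<and> z ^ d = 1)"
  have "d > 0 \<and> z ^ d = 1"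
    using LeastI[of "\<lambda>d. d > 0 \<and> z ^ d = 1" n] z assms by (simp add: d_def)
  moreover have "z ^ e \<noteq> 1" if "0 < e" "e < d" for e
    using not_less_Least[of e "\<lambda>d. d > 0 \<and> z ^ d = 1"] that by (auto simp: d_def)
  ultimately have "z \<in> primitive_roots d" "d > 0" by (auto simp: primitive_roots_def)
  then show "z \<in> (\<Union>d\<in>{d. d dvd n}. primitive_roots d)"
    using primitive_roots_dvd[of z d n] z by auto
next
  fix z assume "z \<in> (\<Union>d\<in>{d. d dvd n}. primitive_roots d)"
  then obtain d k where "z ^ d = 1" "n = d * k" by (auto simp: primitive_roots_def dvd_def)
  then show "z \<in> {z. z ^ n = 1}" by (simp add: power_mult)
qed

text \<open>Both sides are monic of degree \<open>n\<close>, so their difference has degree below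
  \<open>n\<close>; vanishing at all \<open>n\<close> roots of unity, it must be zero.\<close>

lemma prod_roots_unity:
  assumes "n > 0" shows "(\<Prod>z\<in>{z::complex. z ^ n = 1}. [:- z, 1:]) = monom 1 n - 1"
proof -
  let ?p = "\<Prod>z\<in>{z::complex. z ^ n = 1}. [:- z, 1:]" and ?r = "monom 1 n - 1 :: complex poly"
  have fin: "finite {z::complex. z ^ n = 1}" using assms by (rule finite_roots_unity)
  have card: "card {z::complex. z ^ n = 1} = n" using assms by (rule card_roots_unity_eq)
  have deg: "degree ?p = n" by (subst degree_prod_eq_sum_degree) (auto simp: card)
  have lead: "lead_coeff ?p = 1" by (simp add: lead_coeff_prod)
  show ?thesis
  proof (rule ccontr)
    assume "?p \<noteq> ?r"
    define h where "h = ?p - ?r"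
    have h0: "h \<noteq> 0" using \<open>?p \<noteq> ?r\<close> by (simp add: h_def)
    have "degree h < n"
    proof (rule degree_lessI)
      show "\<forall>k\<ge>n. coeff h k = 0"
      proof (intro allI impI)
        fix k assume "n \<le> k"
        show "coeff h k = 0"
        proof (cases "k = n")
          case True
          have "coeff ?p n = 1" using lead by (simp only: deg)
          then show ?thesis using True assms by (simp add: h_def coeff_1)
        next
          case False
          then have "k > n" using \<open>n \<le> k\<close> by simp
          then have "coeff ?p k = 0" by (intro coeff_eq_0) (simp only: deg)
          then show ?thesis using \<open>k > n\<close> by (simp add: h_def coeff_1)
        qed
      qed
    qed (use h0 assms in auto)
    moreover have "card {z. poly h z = 0} \<le> degree h" using h0 by (rule card_poly_roots_bound)
    moreover have "{z. z ^ n = 1} \<subseteq> {z. poly h z = 0}"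
      using fin by (auto simp: h_def poly_prod poly_monom)
    then have "card {z::complex. z ^ n = 1} \<le> card {z. poly h z = 0}"
      using poly_roots_finite[OF h0] by (rule card_mono[rotated])
    ultimately show False using card by simp
  qed
qed

lemma prod_cyclotomic:
  assumes "finite D" "0 \<notin> D"
  shows "(\<Prod>z\<in>(\<Union>d\<in>D. primitive_roots d). [:- z, 1:]) = (\<Prod>d\<in>D. cyclotomic d)"
  unfolding cyclotomic_def using assms
proof (intro prod.UNION_disjoint ballI impI)
  fix i j assume "i \<in> D" "j \<in> D" "i \<noteq> j"
  with assms show "primitive_roots i \<inter> primitive_roots j = {}"
    by (intro primitive_roots_disjoint) (auto intro: gr0I)
next
  fix i assume "i \<in> D"
  with assms show "finite (primitive_roots i)" by (intro finite_primitive_roots) (auto intro: gr0I)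
qed auto

lemma monom_minus_one_eq_prod_cyclotomic:
  assumes "n > 0" shows "monom 1 n - 1 = (\<Prod>d\<in>{d. d dvd n}. cyclotomic d)"
  using prod_cyclotomic[of "{d. d dvd n}"] assms
  by (simp add: prod_roots_unity flip: roots_unity_eq_Union_primitive_roots)

text \<open>By induction the factors belonging to proper divisors have a monic integral product, and
  dividing \<open>monom 1 n - 1\<close> by it keeps the coefficients integral.\<close>

lemma int_coeffs_cyclotomic: "n > 0 \<Longrightarrow> int_coeffs (cyclotomic n)"
proof (induction n rule: less_induct)
  case (less n)
  let ?m = "\<Prod>d\<in>{d. d dvd n} - {n}. cyclotomic d"
  have "monom 1 n - 1 = cyclotomic n * ?m"
    unfolding monom_minus_one_eq_prod_cyclotomic[OF less.prems]
    by (rule prod.remove) (use less.prems in auto)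
  moreover have "int_coeffs (monom 1 n - 1)" by (auto simp: int_coeffs_def coeff_1)
  moreover have "int_coeffs ?m"
    using less by (intro int_coeffs_prod) (auto dest: dvd_imp_le intro!: less.IH gr0I simp: order_le_less)
  moreover have "lead_coeff ?m = 1"
    by (simp add: lead_coeff_prod cyclotomic_def)
  ultimately show ?case using int_coeffs_monic_cofactor by metis
qed

lemma primitive_root_exists:
  assumes "n > 0" shows "cis (2 * pi / n) \<in> primitive_roots n"
proof -
  have "cis (2 * pi / n) ^ d \<noteq> 1" if "0 < d" "d < n" for d
  proof
    assume *: "cis (2 * pi / n) ^ d = 1"
    have "inj_on (\<lambda>k. cis (2 * pi * real k / real n)) {..<n}"
      using bij_betw_roots_unity[OF assms] by (rule bij_betw_imp_inj_on)
    moreover have "cis (2 * pi * real d / real n) = cis (2 * pi * real 0 / real n)"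
      using * by (simp add: DeMoivre mult_ac)
    ultimately have "d = 0"
      by (rule inj_onD) (use that assms in auto)
    with that show False by simp
  qed
  then show ?thesis using assms by (auto simp: primitive_roots_def DeMoivre)
qed

text \<open>A root \<open>z\<close> lies on the unit circle and differs from 1, so its real part is
  below 1 and its distance from \<open>q\<close> exceeds \<open>q - 1 \<ge> 1\<close>.\<close>

lemma cyclotomic_gt:
  assumes "n \<ge> 2" "q \<ge> 2"
  shows "norm (poly (cyclotomic n) (of_nat q)) > real q - 1"
proof -
  have fin: "finite (primitive_roots n)" using assms by (intro finite_primitive_roots) auto
  have gt: "norm (of_nat q - z) > real q - 1" if "z \<in> primitive_roots n" for z
  proof -
    have "z ^ n = 1" "z ^ 1 \<noteq> 1" using that assms by (auto simp: primitive_roots_def)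
    then have nz: "norm z = 1" using assms by (metis norm_one norm_power power_eq_1_iff not_numeral_le_zero norm_ge_zero)
    have "Re z \<noteq> 1"
    proof
      assume "Re z = 1"
      then have "Im z = 0" using nz by (simp add: cmod_def)
      with \<open>Re z = 1\<close> have "z = 1" by (simp add: complex_eq_iff)
      with \<open>z ^ 1 \<noteq> 1\<close> show False by simp
    qed
    then have "Re z < 1" using complex_Re_le_cmod[of z] nz by simp
    then have "real q - 1 < Re (of_nat q - z)" by simp
    also have "\<dots> \<le> norm (of_nat q - z)" by (rule complex_Re_le_cmod)
    finally show ?thesis .
  qed
  \<comment> \<open>At least one factor is needed: an empty product would only be 1.\<close>
  obtain w where w: "w \<in> primitive_roots n" using primitive_root_exists[of n] assms by auto
  have "norm (poly (cyclotomic n) (of_nat q)) = (\<Prod>z\<in>primitive_roots n. norm (of_nat q - z))"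
    by (simp add: cyclotomic_def poly_prod flip: prod_norm)
  also have "\<dots> = norm (of_nat q - w) * (\<Prod>z\<in>primitive_roots n - {w}. norm (of_nat q - z))"
    using fin w by (rule prod.remove)
  also have "\<dots> \<ge> norm (of_nat q - w) * 1"
  proof (intro mult_left_mono prod_ge_1)
    fix z assume "z \<in> primitive_roots n - {w}"
    then show "1 \<le> norm (of_nat q - z)" using gt[of z] assms by force
  qed auto
  finally show ?thesis using gt[OF w] by simp
qed

text \<open>\<open>c\<close> is the absolute value of the \<open>n\<close>-th cyclotomic polynomial
  at \<open>q\<close>. For a proper divisor \<open>d\<close> this polynomial is not among the
  factors of \<open>monom 1 d - 1\<close>, so the two divide \<open>monom 1 n - 1\<close> jointly,
  with an integral cofactor.\<close>

lemma cyclotomic_value: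
  fixes n q :: nat
  assumes "n \<ge> 2" "q \<ge> 2"
  obtains c :: int where "c > int q - 1"
    "\<And>d. d dvd n \<Longrightarrow> d < n \<Longrightarrow> c * (int q ^ d - 1) dvd int q ^ n - 1"
proof -
  have "poly (cyclotomic n) (of_nat q) \<in> \<int>"
    using assms by (intro poly_int_coeffs int_coeffs_cyclotomic) auto
  then obtain c where c: "poly (cyclotomic n) (of_nat q) = of_int c" by (elim Ints_cases)
  have dvd: "c * (int q ^ d - 1) dvd int q ^ n - 1" if d: "d dvd n" "d < n" for d
  proof -
    have n0: "n > 0" and d0: "d > 0" using d assms by (auto intro: gr0I)
    \<comment> \<open>The divisors of \<open>n\<close> other than \<open>n\<close> that do not
      divide \<open>d\<close>; they index the cofactor.\<close>
    let ?D = "{e. e dvd n} - {e. e dvd d} - {n}"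
    let ?g = "\<Prod>e\<in>?D. cyclotomic e"
    have split: "{e. e dvd n} = insert n ({e. e dvd d} \<union> ?D)" using d by auto
    have nd: "n \<notin> {e. e dvd d} \<union> ?D" using d d0 by (auto dest: dvd_imp_le)
    have "(monom 1 n - 1 :: complex poly) = cyclotomic n * ((monom 1 d - 1) * ?g)"
      unfolding monom_minus_one_eq_prod_cyclotomic[OF n0] monom_minus_one_eq_prod_cyclotomic[OF d0]
      using d0 n0 nd by (subst split, subst prod.insert, simp, simp)
        (subst prod.union_disjoint, auto)
    then have "poly (monom 1 n - 1) (of_nat q :: complex)
        = poly (cyclotomic n * ((monom 1 d - 1) * ?g)) (of_nat q)" by simp
    then have eq: "(of_nat q ^ n - 1 :: complex) = of_int c * ((of_nat q ^ d - 1) * poly ?g (of_nat q))"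
      by (simp add: poly_monom c)
    have "poly ?g (of_nat q) \<in> \<int>"
      using n0 by (intro poly_int_coeffs int_coeffs_prod int_coeffs_cyclotomic) (auto intro: gr0I)
    then obtain g where "poly ?g (of_nat q) = of_int g" by (elim Ints_cases)
    with eq have "(of_int (int q ^ n - 1) :: complex) = of_int (c * (int q ^ d - 1) * g)" by simp
    then show ?thesis by (metis dvd_triv_left of_int_eq_iff)
  qed
  have "\<bar>c\<bar> > int q - 1"
    using cyclotomic_gt[OF assms] by (simp add: c)
  \<comment> \<open>Only the norm is bounded below, so the sign of \<open>c\<close> is dropped;
    divisibility does not see it.\<close>
  then show ?thesis using that[of "\<bar>c\<bar>"] dvd by (simp add: abs_if split: if_splits)
qed

section \<open>Finite division rings\<close>

text \<open>Euclidean descent on exponents: \<open>q ^ n - 1\<close> and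
  \<open>q ^ (n - d) - 1\<close> agree modulo \<open>q ^ d - 1\<close>, and an exponent below
  \<open>d\<close> must be 0.\<close>

lemma dvd_exponent_of_power_minus_one_dvd:
  fixes q d n :: nat
  assumes "q \<ge> 2" "d > 0" "q ^ d - 1 dvd q ^ n - 1"
  shows "d dvd n"
  using assms(3)
proof (induction n rule: less_induct)
  case (less n)
  show ?case
  proof (cases "n < d")
    case True
    then have "q ^ n < q ^ d" using assms by simp
    then have "q ^ n - 1 < q ^ d - 1" using assms by (simp add: diff_less_mono)
    then have "q ^ n - 1 = 0" using less.prems by (meson dvd_imp_le gr0I linorder_not_le)
    moreover have "q ^ n > 1" if "n > 0" using assms that by (intro one_less_power) auto
    ultimately have "n = 0" by (cases "n = 0") auto
    then show ?thesis by simp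
  next
    case False
    define r where "r = n - d"
    have n: "n = d + r" using False by (simp add: r_def)
    have "q ^ n - 1 = q ^ r * (q ^ d - 1) + (q ^ r - 1)"
      using assms by (simp add: n power_add algebra_simps)
    then have "q ^ d - 1 dvd q ^ r - 1"
      using less.prems by (metis dvd_add_right_iff dvd_triv_right)
    then have "d dvd r" using less.IH[of r] n assms by simp
    then show ?thesis by (simp add: n)
  qed
qed

text \<open>Formulated with a carrier set because it will be applied to a residue ring living on
  representatives inside the type \<open>'r\<close>.\<close>

locale finite_division_ring = ring R for R (structure) +
  assumes finite_carrier: "finite (carrier R)"
    and one_not_zero: "\<one> \<noteq> \<zero>"
    and Units_eq: "Units R = carrier R - {\<zero>}"
begin

section \<open>The division ring as a vector space over its center\<close>

definition center :: "'a set" where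
  "center = {z \<in> carrier R. \<forall>x\<in>carrier R. z \<otimes> x = x \<otimes> z}"

definition centralizer :: "'a \<Rightarrow> 'a set" where
  "centralizer a = {x \<in> carrier R. x \<otimes> a = a \<otimes> x}"

definition center_subspace :: "'a set \<Rightarrow> bool" where
  "center_subspace V \<longleftrightarrow> V \<subseteq> carrier R \<and> \<zero> \<in> V \<and> (\<forall>x\<in>V. \<forall>y\<in>V. x \<oplus> y \<in> V)
     \<and> (\<forall>z\<in>center. \<forall>x\<in>V. z \<otimes> x \<in> V)"

lemma center_closed: "z \<in> center \<Longrightarrow> z \<in> carrier R"
  by (simp add: center_def)

lemma center_minus_one: "\<ominus> \<one> \<in> center"
  by (simp add: center_def l_minus r_minus)

lemma center_add: "y \<in> center \<Longrightarrow> z \<in> center \<Longrightarrow> y \<oplus> z \<in> center"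
  by (simp add: center_def l_distr r_distr)

lemma center_mult:
  assumes "y \<in> center" "z \<in> center" shows "y \<otimes> z \<in> center"
proof -
  have c: "y \<in> carrier R" "z \<in> carrier R" using assms by (auto simp: center_def)
  have "y \<otimes> z \<otimes> x = x \<otimes> (y \<otimes> z)" if x: "x \<in> carrier R" for x
  proof -
    have "y \<otimes> z \<otimes> x = y \<otimes> (x \<otimes> z)" using assms(2) c x by (simp add: m_assoc center_def)
    also have "\<dots> = x \<otimes> y \<otimes> z" using assms(1) c x by (simp add: center_def flip: m_assoc)
    finally show ?thesis using c x by (simp add: m_assoc)
  qed
  then show ?thesis using c by (simp add: center_def)
qed

lemma center_minus: "z \<in> center \<Longrightarrow> \<ominus> z \<in> center"
  by (simp add: center_def l_minus r_minus)

lemma center_diff: "y \<in> center \<Longrightarrow> z \<in> center \<Longrightarrow> y \<ominus> z \<in> center"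
  by (simp add: minus_eq center_add center_minus)

lemma center_inv:
  assumes "z \<in> center" "z \<noteq> \<zero>" shows "inv z \<in> center"
proof -
  have z: "z \<in> Units R" using assms by (simp add: Units_eq center_closed)
  have "inv z \<otimes> x = x \<otimes> inv z" if x: "x \<in> carrier R" for x
  proof -
    have "inv z \<otimes> x = inv z \<otimes> (x \<otimes> z) \<otimes> inv z"
      using z x by (simp add: m_assoc Units_closed)
    also have "x \<otimes> z = z \<otimes> x" using assms x by (simp add: center_def)
    also have "inv z \<otimes> (z \<otimes> x) \<otimes> inv z = x \<otimes> inv z"
      using z x by (simp add: Units_closed flip: m_assoc)
    finally show ?thesis .
  qed
  then show ?thesis using z by (simp add: center_def)
qed

lemma finite_center: "finite center"
  using finite_carrier by (simp add: center_def)

lemma card_center_ge_2: "card center \<ge> 2"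
proof -
  have "{\<zero>, \<one>} \<subseteq> center" by (auto simp: center_def)
  then have "card {\<zero>, \<one>} \<le> card center" using finite_center by (rule card_mono[rotated])
  then show ?thesis using one_not_zero by simp
qed

lemma center_subspace_minus:
  assumes "center_subspace V" "x \<in> V" shows "\<ominus> x \<in> V"
proof -
  have "x \<in> carrier R" using assms by (auto simp: center_subspace_def)
  then have "\<ominus> x = \<ominus> \<one> \<otimes> x" by (simp add: l_minus)
  then show ?thesis using assms center_minus_one by (simp add: center_subspace_def)
qed

text \<open>The sum of \<open>W\<close> and the center multiples of \<open>v\<close> is direct: two
  representations with \<open>z \<noteq> z'\<close> would put
  \<open>(z \<ominus> z') \<otimes> v\<close> into \<open>W\<close>, and then also \<open>v\<close>,
  since \<open>z \<ominus> z'\<close> has a central inverse.\<close>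

lemma center_subspace_extend:
  assumes W: "center_subspace W" and v: "v \<in> carrier R" "v \<notin> W"
  defines "W' \<equiv> (\<lambda>(w, z). w \<oplus> z \<otimes> v) ` (W \<times> center)"
  shows "center_subspace W'" "card W' = card W * card center"
proof -
  have Wc: "w \<in> carrier R" if "w \<in> W" for w using W that by (auto simp: center_subspace_def)
  show "center_subspace W'" unfolding center_subspace_def
  proof (intro conjI ballI)
    show "W' \<subseteq> carrier R" using v by (auto simp: W'_def Wc center_closed)
    have "\<zero> = \<zero> \<oplus> \<zero> \<otimes> v" using v by simp
    moreover have "\<zero> \<in> W" "\<zero> \<in> center" using W by (auto simp: center_subspace_def center_def)
    ultimately show "\<zero> \<in> W'" unfolding W'_def by (intro image_eqI[of _ _ "(\<zero>, \<zero>)"]) auto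
  next
    fix x y assume "x \<in> W'" "y \<in> W'"
    then obtain w z w' z' where *: "w \<in> W" "z \<in> center" "w' \<in> W" "z' \<in> center"
      "x = w \<oplus> z \<otimes> v" "y = w' \<oplus> z' \<otimes> v" by (auto simp: W'_def)
    then have "x \<oplus> y = (w \<oplus> w') \<oplus> (z \<oplus> z') \<otimes> v"
      using v by (simp add: Wc center_closed l_distr a_ac)
    moreover have "w \<oplus> w' \<in> W" "z \<oplus> z' \<in> center"
      using * W by (auto simp: center_subspace_def center_add)
    ultimately show "x \<oplus> y \<in> W'" unfolding W'_def by (intro image_eqI[of _ _ "(w \<oplus> w', z \<oplus> z')"]) auto
  next
    fix y x assume "y \<in> center" "x \<in> W'"
    then obtain w z where *: "w \<in> W" "z \<in> center" "x = w \<oplus> z \<otimes> v" by (auto simp: W'_def)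
    then have "y \<otimes> x = y \<otimes> w \<oplus> (y \<otimes> z) \<otimes> v"
      using v \<open>y \<in> center\<close> by (simp add: Wc center_closed r_distr m_assoc)
    moreover have "y \<otimes> w \<in> W" "y \<otimes> z \<in> center"
      using * W \<open>y \<in> center\<close> by (auto simp: center_subspace_def center_mult)
    ultimately show "y \<otimes> x \<in> W'" unfolding W'_def by (intro image_eqI[of _ _ "(y \<otimes> w, y \<otimes> z)"]) auto
  qed
  have "inj_on (\<lambda>(w, z). w \<oplus> z \<otimes> v) (W \<times> center)"
  proof (rule inj_onI, clarify)
    fix w z w' z' assume *: "w \<in> W" "z \<in> center" "w' \<in> W" "z' \<in> center"
      "w \<oplus> z \<otimes> v = w' \<oplus> z' \<otimes> v"
    have c: "w \<in> carrier R" "w' \<in> carrier R" "z \<in> carrier R" "z' \<in> carrier R"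
      using * by (auto simp: Wc center_closed)
    have "z = z'"
    proof (rule ccontr)
      assume "z \<noteq> z'"
      define y where "y = z \<ominus> z'"
      have yc: "y \<in> center" using * by (simp add: y_def center_diff)
      have y0: "y \<noteq> \<zero>" using c \<open>z \<noteq> z'\<close> unfolding y_def by (metis minus_eq minus_equality minus_minus a_inv_closed)
      have yU: "y \<in> Units R" using yc y0 by (simp add: Units_eq center_closed)
      have "y \<otimes> v = \<ominus> w \<oplus> (w \<oplus> z \<otimes> v) \<oplus> \<ominus> (z' \<otimes> v)"
        using c v unfolding y_def by algebra
      also have "\<dots> = w' \<oplus> \<ominus> w"
        unfolding *(5) using c v by algebra
      finally have "y \<otimes> v \<in> W"
        using W * center_subspace_minus[OF W] by (auto simp: center_subspace_def)
      then have "inv y \<otimes> (y \<otimes> v) \<in> W"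
        using W center_inv[OF yc y0] by (simp add: center_subspace_def)
      then show False using v yU by (simp add: Units_closed flip: m_assoc)
    qed
    then show "w = w' \<and> z = z'" using * c v by simp
  qed
  then show "card W' = card W * card center"
    by (simp add: W'_def card_image card_cartesian_product)
qed

text \<open>Stands in for the existence of a basis: among the subspaces of \<open>V\<close> whose
  size is a power of \<open>card center\<close>, a largest one is \<open>V\<close> itself, since
  otherwise it could be extended by one more vector.\<close>

lemma card_center_subspace:
  assumes V: "center_subspace V"
  shows "\<exists>e. card V = card center ^ e"
proof -
  define S where "S = {W. W \<subseteq> V \<and> center_subspace W \<and> (\<exists>e. card W = card center ^ e)}"
  have finV: "finite V" using V finite_carrier by (auto simp: center_subspace_def intro: finite_subset)
  then have finS: "finite S" unfolding S_def by (auto intro: finite_subset[of _ "Pow V"])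
  have "{\<zero>} \<in> S" using V by (auto simp: S_def center_subspace_def center_closed intro: exI[of _ 0])
  then have "Max (card ` S) \<in> card ` S" using finS by (intro Max_in) auto
  then obtain W where W: "W \<in> S" and "card W = Max (card ` S)" by auto
  then have max: "card U \<le> card W" if "U \<in> S" for U using that finS by simp
  have "W = V"
  proof (rule ccontr)
    assume "W \<noteq> V"
    then obtain v where v: "v \<in> V" "v \<notin> W" using W by (auto simp: S_def)
    define U where "U = (\<lambda>(w, z). w \<oplus> z \<otimes> v) ` (W \<times> center)"
    have vc: "v \<in> carrier R" using V v by (auto simp: center_subspace_def)
    have WS: "center_subspace W" "W \<subseteq> V" using W by (auto simp: S_def)
    have "U \<subseteq> V" unfolding U_def using V v WS by (auto simp: center_subspace_def)
    moreover obtain e where e: "card W = card center ^ e" using W by (auto simp: S_def)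
    moreover have "card U = card W * card center" "center_subspace U"
      unfolding U_def by (rule center_subspace_extend[OF WS(1) vc v(2)])+
    moreover have "card W * card center = card center ^ Suc e" using e by simp
    ultimately have "U \<in> S" unfolding S_def by (metis (mono_tags, lifting) mem_Collect_eq)
    then have "card W * card center \<le> card W" using max \<open>card U = _\<close> by metis
    moreover have "card W > 0" using e card_center_ge_2 by simp
    ultimately show False using card_center_ge_2 by simp
  qed
  then show ?thesis using W by (simp add: S_def)
qed

lemma center_subspace_centralizer:
  assumes a: "a \<in> carrier R" shows "center_subspace (centralizer a)"
  unfolding center_subspace_def
proof (intro conjI ballI)
  fix x y assume "x \<in> centralizer a" "y \<in> centralizer a"
  with a show "x \<oplus> y \<in> centralizer a" by (simp add: centralizer_def l_distr r_distr)
next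
  fix z x assume z: "z \<in> center" and x: "x \<in> centralizer a"
  have c: "z \<in> carrier R" "x \<in> carrier R" "x \<otimes> a = a \<otimes> x" "z \<otimes> a = a \<otimes> z"
    using z x a by (auto simp: center_def centralizer_def)
  have "z \<otimes> x \<otimes> a = z \<otimes> (a \<otimes> x)" using c a by (simp add: m_assoc)
  also have "\<dots> = a \<otimes> (z \<otimes> x)" using c a by (simp flip: m_assoc)
  finally show "z \<otimes> x \<in> centralizer a" using c by (simp add: centralizer_def)
qed (use a in \<open>auto simp: centralizer_def\<close>)

text \<open>Witt's argument: a nontrivial conjugacy class has size \<open>(q\<^sup>n - 1) / (q\<^sup>d - 1)\<close> with \<open>d\<close> a proper
  divisor of \<open>n\<close>, where \<open>q\<close> is the size of the center; the class equation then makes the value of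
  the \<open>n\<close>-th cyclotomic polynomial at \<open>q\<close> a divisor of \<open>q - 1\<close>, which it exceeds.\<close>
theorem wedderburn:
  assumes "x \<in> carrier R" "y \<in> carrier R"
  shows "x \<otimes> y = y \<otimes> x"
proof (rule ccontr)
  assume "x \<otimes> y \<noteq> y \<otimes> x"
  then have ne: "center \<noteq> carrier R" using assms by (auto simp: center_def)
  let ?q = "card center"
  have "center_subspace (carrier R)" by (auto simp: center_subspace_def center_closed)
  then obtain n where n: "card (carrier R) = ?q ^ n" using card_center_subspace by blast
  have "?q < card (carrier R)"
    using ne finite_carrier by (intro psubset_card_mono) (auto simp: center_def)
  then have n2: "n \<ge> 2" using card_center_ge_2 unfolding n by (cases n; cases "n - 1") auto
  obtain c :: int where c: "c > int ?q - 1"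
    "\<And>d. d dvd n \<Longrightarrow> d < n \<Longrightarrow> c * (int ?q ^ d - 1) dvd int ?q ^ n - 1"
    using cyclotomic_value[OF n2 card_center_ge_2] by blast
  let ?G = "units_of R"
  interpret G: group ?G by (rule units_group)
  have carG: "carrier ?G = carrier R - {\<zero>}" by (simp add: units_of_carrier Units_eq)
  have ordG: "order ?G = ?q ^ n - 1"
    using finite_carrier by (simp add: order_def carG n card_Diff_singleton)
  define \<phi> where "\<phi> = (\<lambda>g. \<lambda>h \<in> carrier ?G. g \<otimes>\<^bsub>?G\<^esub> h \<otimes>\<^bsub>?G\<^esub> (inv\<^bsub>?G\<^esub> g))"
  interpret A: group_action ?G "carrier ?G" \<phi> unfolding \<phi>_def by (rule G.action_by_conjugation)
  have fixed_iff: "\<phi> g a = a \<longleftrightarrow> g \<otimes> a = a \<otimes> g" if "g \<in> carrier ?G" "a \<in> carrier ?G" for g a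
  proof -
    have "\<phi> g a = a \<longleftrightarrow> a = g \<otimes>\<^bsub>?G\<^esub> a \<otimes>\<^bsub>?G\<^esub> inv\<^bsub>?G\<^esub> g" using that by (auto simp: \<phi>_def)
    also have "\<dots> \<longleftrightarrow> g \<otimes>\<^bsub>?G\<^esub> a = a \<otimes>\<^bsub>?G\<^esub> g"
      using G.inv_solve_right[of a "g \<otimes>\<^bsub>?G\<^esub> a" g] that G.m_closed by auto
    finally show ?thesis by (simp add: units_of_mult)
  qed
  have orbit_dvd: "c dvd int (card (orbit ?G \<phi> a))" if a: "a \<in> carrier R - center" for a
  proof -
    have aG: "a \<in> carrier ?G" using a by (auto simp: carG center_def)
    have "center_subspace (centralizer a)" using a by (simp add: center_subspace_centralizer)
    then obtain d where d: "card (centralizer a) = ?q ^ d" using card_center_subspace by blast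
    obtain x where "x \<in> carrier R" "a \<otimes> x \<noteq> x \<otimes> a" using a by (auto simp: center_def)
    then have "x \<in> carrier R" "x \<notin> centralizer a" by (auto simp: centralizer_def)
    then have "centralizer a \<noteq> carrier R" by blast
    then have "card (centralizer a) < card (carrier R)"
      using finite_carrier by (intro psubset_card_mono) (auto simp: centralizer_def)
    then have "d < n" unfolding n d using card_center_ge_2 by simp
    have "{\<zero>, \<one>} \<subseteq> centralizer a" using a by (auto simp: centralizer_def)
    then have "card {\<zero>, \<one>} \<le> card (centralizer a)"
      using finite_carrier by (intro card_mono) (auto simp: centralizer_def)
    then have "d > 0" using one_not_zero d by (auto intro: gr0I)
    \<comment> \<open>Adjoining zero to the stabilizer gives the centralizer, a subspace over the
      center, so its size is a power of \<open>?q\<close>.\<close>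
    have "stabilizer ?G \<phi> a = centralizer a - {\<zero>}"
      using aG fixed_iff by (auto simp: stabilizer_def centralizer_def carG)
    moreover have "\<zero> \<in> centralizer a" using a by (simp add: centralizer_def)
    ultimately have "card (stabilizer ?G \<phi> a) = ?q ^ d - 1"
      using d by (simp add: card_Diff_singleton)
    then have orb: "card (orbit ?G \<phi> a) * (?q ^ d - 1) = ?q ^ n - 1"
      using A.orbit_stabilizer_theorem[OF aG] ordG by simp
    then have "?q ^ d - 1 dvd ?q ^ n - 1" by (intro dvdI[of _ _ "card (orbit ?G \<phi> a)"]) (simp only: mult.commute)
    then have "d dvd n"
      by (rule dvd_exponent_of_power_minus_one_dvd[OF card_center_ge_2 \<open>d > 0\<close>])
    then have dv: "c * (int ?q ^ d - 1) dvd int ?q ^ n - 1" using c \<open>d < n\<close> by blast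
    have pos: "?q ^ d > 1" "?q ^ n > 1" using card_center_ge_2 \<open>d > 0\<close> n2 by (auto intro!: one_less_power simp del: One_nat_def)
    have "int (card (orbit ?G \<phi> a)) * (int ?q ^ d - 1) = int ?q ^ n - 1"
      using arg_cong[OF orb, of int] pos by (simp add: of_nat_diff)
    then have "c * (int ?q ^ d - 1) dvd int (card (orbit ?G \<phi> a)) * (int ?q ^ d - 1)"
      using dv by (simp only:)
    moreover have "int (?q ^ d) > 1" using pos(1) by linarith
    then have "int ?q ^ d - 1 \<noteq> 0" by simp
    ultimately show ?thesis by (subst (asm) dvd_times_right_cancel_iff)
  qed
  let ?C = "(orbit ?G \<phi>) ` (carrier R - center)"
  have Csub: "?C \<subseteq> orbits ?G (carrier ?G) \<phi>"
  proof
    fix X assume "X \<in> ?C"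
    then obtain a where a: "a \<in> carrier R - center" "X = orbit ?G \<phi> a" by (rule imageE)
    then have "a \<in> carrier ?G" by (auto simp: carG center_def)
    with a(2) show "X \<in> orbits ?G (carrier ?G) \<phi>" unfolding orbits_def by blast
  qed
  \<comment> \<open>A central element is fixed by every conjugation, so the orbit of a noncentral
    element stays outside the center; these orbits partition the complement.\<close>
  have UC: "\<Union>?C = carrier R - center"
  proof
    show "carrier R - center \<subseteq> \<Union>?C"
    proof
      fix a assume a: "a \<in> carrier R - center"
      then have "a \<in> carrier ?G" by (auto simp: carG center_def)
      then show "a \<in> \<Union>?C" using A.orbit_refl a by blast
    qed
    show "\<Union>?C \<subseteq> carrier R - center"
    proof clarify
      fix a b assume a: "a \<in> carrier R" "a \<notin> center" and b: "b \<in> orbit ?G \<phi> a"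
      have aG: "a \<in> carrier ?G" using a by (auto simp: carG center_def)
      have bG: "b \<in> carrier ?G" using b A.element_image[OF _ aG] by (auto simp: orbit_def)
      have "b \<notin> center"
      proof
        assume "b \<in> center"
        obtain g where g: "g \<in> carrier ?G" "\<phi> g b = a"
          using A.orbit_sym[OF aG bG b] by (auto simp: orbit_def)
        have "\<phi> g b = b" using fixed_iff[OF g(1) bG] g(1) \<open>b \<in> center\<close> by (simp add: center_def carG)
        with g \<open>b \<in> center\<close> a show False by simp
      qed
      then show "b \<in> carrier R - center" using bG by (simp add: carG)
    qed
  qed
  have "nat c dvd card (\<Union>?C)"
  proof (rule dvd_partition)
    show "finite (\<Union>?C)" unfolding UC using finite_carrier by simp
    show "\<forall>X\<in>?C. nat c dvd card X" using orbit_dvd c(1) card_center_ge_2 by (auto simp: nat_dvd_iff)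
    show "\<forall>X\<in>?C. \<forall>Y\<in>?C. X \<noteq> Y \<longrightarrow> X \<inter> Y = {}"
      using A.disjoint_union Csub by blast
  qed
  then have "c dvd int (card (carrier R - center))" unfolding UC using c(1) card_center_ge_2 by (simp add: nat_dvd_iff)
  also have "int (card (carrier R - center)) = int ?q ^ n - int ?q"
    using finite_center n \<open>?q < card (carrier R)\<close> center_closed
    by (subst card_Diff_subset) auto
  finally have 1: "c dvd int ?q ^ n - int ?q" .
  have "c * (int ?q ^ 1 - 1) dvd int ?q ^ n - 1" using n2 by (intro c(2)) auto
  then have 2: "c dvd int ?q ^ n - 1" by (rule dvd_mult_left)
  \<comment> \<open>Both the unit group and the set of noncentral elements have size divisible by
    \<open>c\<close>; the difference of the two sizes is \<open>?q - 1\<close>.\<close>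
  have "c dvd (int ?q ^ n - 1) - (int ?q ^ n - int ?q)" using 2 1 by (rule dvd_diff)
  then have "c dvd int ?q - 1" by simp
  then have "c \<le> int ?q - 1" using card_center_ge_2 by (intro zdvd_imp_le) auto
  with c(1) show False by simp
qed

end

section \<open>Chain rings of length two\<close>

text \<open>The second assumption makes \<open>q\<close> the index of \<open>N\<close>, that is, the
  size of the residue ring; \<open>card_N\<close> shows that \<open>N\<close> itself has
  \<open>q\<close> elements too.\<close>

locale chain_ring =
  fixes N :: "'r::{ring_1,finite} set" and q :: nat
  assumes chain: "chain_ring2 N" and card_UNIV_eq: "card (UNIV :: 'r set) = q * card N"
begin

lemma right_ideal_cases: "right_ideal I \<Longrightarrow> I = UNIV \<or> I = N \<or> I = {0}"
  using chain unfolding chain_ring2_def by blast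

lemma left_ideal_cases: "left_ideal I \<Longrightarrow> I = UNIV \<or> I = N \<or> I = {0}"
  using chain unfolding chain_ring2_def by blast

lemma right_ideal_N: "right_ideal N" and left_ideal_N: "left_ideal N"
  using chain unfolding chain_ring2_def by blast+

lemma N_zero [simp]: "0 \<in> N"
  and N_add: "x \<in> N \<Longrightarrow> y \<in> N \<Longrightarrow> x + y \<in> N"
  and N_minus: "x \<in> N \<Longrightarrow> - x \<in> N"
  and N_mult_right: "x \<in> N \<Longrightarrow> x * r \<in> N"
  using right_ideal_N by (auto simp: right_ideal_def)

lemma N_mult_left: "x \<in> N \<Longrightarrow> r * x \<in> N"
  using left_ideal_N by (auto simp: left_ideal_def)

lemma N_diff: "x \<in> N \<Longrightarrow> y \<in> N \<Longrightarrow> x - y \<in> N"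
  using N_add[of x "- y"] N_minus by simp

lemma N_mult_N: "x \<in> N \<Longrightarrow> y \<in> N \<Longrightarrow> x * y = 0"
  using chain unfolding chain_ring2_def by blast

lemma N_diff_commute: "x - y \<in> N \<longleftrightarrow> y - x \<in> N"
  using N_minus by (metis minus_diff_eq)

lemma right_ideal_range: "right_ideal (range ((*) (x :: 'r)))"
  unfolding right_ideal_def
proof (intro conjI ballI allI)
  show "0 \<in> range ((*) x)" by (rule range_eqI[of _ _ 0]) simp
  fix y assume "y \<in> range ((*) x)"
  then obtain a where a: "y = x * a" by blast
  show "- y \<in> range ((*) x)" by (rule range_eqI[of _ _ "- a"]) (simp add: a)
  show "y * r \<in> range ((*) x)" for r by (rule range_eqI[of _ _ "a * r"]) (simp add: a mult.assoc)
  fix z assume "z \<in> range ((*) x)"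
  then obtain b where "z = x * b" by blast
  then show "y + z \<in> range ((*) x)"
    by (intro range_eqI[of _ _ "a + b"]) (simp add: a distrib_left)
qed

lemma left_ideal_range: "left_ideal (range (\<lambda>r. r * (x :: 'r)))"
  unfolding left_ideal_def
proof (intro conjI ballI allI)
  show "0 \<in> range (\<lambda>r. r * x)" by (rule range_eqI[of _ _ 0]) simp
  fix y assume "y \<in> range (\<lambda>r. r * x)"
  then obtain a where a: "y = a * x" by blast
  show "- y \<in> range (\<lambda>r. r * x)" by (rule range_eqI[of _ _ "- a"]) (simp add: a)
  show "r * y \<in> range (\<lambda>r. r * x)" for r
    by (rule range_eqI[of _ _ "r * a"]) (simp add: a mult.assoc)
  fix z assume "z \<in> range (\<lambda>r. r * x)"
  then obtain b where "z = b * x" by blast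
  then show "y + z \<in> range (\<lambda>r. r * x)"
    by (intro range_eqI[of _ _ "a + b"]) (simp add: a distrib_right)
qed

text \<open>The right and the left ideal generated by \<open>x\<close> both contain
  \<open>x\<close>, so neither is \<open>N\<close> or zero, and both are the whole ring; the two
  one-sided inverses then agree.\<close>

lemma unit_if_notin_N:
  assumes "x \<notin> N" obtains y where "x * y = 1" "y * x = 1"
proof -
  have "x \<in> range ((*) x)" "x \<in> range (\<lambda>r. r * x)"
    by (rule range_eqI[of _ _ 1], simp)+
  moreover have "x \<noteq> 0" using assms by auto
  ultimately have "range ((*) x) = UNIV" "range (\<lambda>r. r * x) = UNIV"
    using right_ideal_cases[OF right_ideal_range] left_ideal_cases[OF left_ideal_range] assms by blast+
  then obtain y z where yz: "x * y = 1" "z * x = 1" by (metis surjE)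
  then have "z = y" by (metis mult.assoc mult.left_neutral mult.right_neutral)
  with yz that show thesis by blast
qed

lemma one_notin_N: "1 \<notin> N"
proof
  assume "1 \<in> N"
  then have "x \<in> N" for x using N_mult_left[of 1 x] by simp
  then show False using chain by (auto simp: chain_ring2_def)
qed

lemma notin_N_mult_left:
  assumes "x \<notin> N" "x * y \<in> N" shows "y \<in> N"
proof -
  obtain z where "z * x = 1" using unit_if_notin_N[OF assms(1)] by blast
  then have "y = z * (x * y)" by (simp flip: mult.assoc)
  then show ?thesis using N_mult_left[OF assms(2), of z] by simp
qed

lemma annihilator_right:
  assumes "n \<noteq> 0" "n * r = 0" shows "r \<in> N"
proof (rule ccontr)
  assume "r \<notin> N"
  then obtain s where "r * s = 1" using unit_if_notin_N by blast
  then have "n = n * r * s" by (simp add: mult.assoc)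
  with assms show False by simp
qed

lemma annihilator_left:
  assumes "n \<noteq> 0" "r * n = 0" shows "r \<in> N"
proof (rule ccontr)
  assume "r \<notin> N"
  then obtain s where "s * r = 1" using unit_if_notin_N by blast
  then have "n = s * (r * n)" by (simp flip: mult.assoc)
  with assms show False by simp
qed

text \<open>Plays the part of a uniformizer: by \<open>N_eq_range\<close> every element of
  \<open>N\<close> is \<open>gen * b\<close>, with \<open>b\<close> determined modulo
  \<open>N\<close>.\<close>

definition gen :: 'r where
  "gen = (SOME x. x \<in> N \<and> x \<noteq> 0)"

lemma gen: "gen \<in> N" "gen \<noteq> 0"
proof -
  have "\<exists>x. x \<in> N \<and> x \<noteq> 0" using chain N_zero unfolding chain_ring2_def by blast
  then have "gen \<in> N \<and> gen \<noteq> 0" unfolding gen_def by (rule someI_ex)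
  then show "gen \<in> N" "gen \<noteq> 0" by auto
qed

lemma N_eq_range:
  assumes "n \<in> N" "n \<noteq> 0" shows "range ((*) n) = N"
proof -
  have "n \<in> range ((*) n)" by (rule range_eqI[of _ _ 1]) simp
  moreover have "range ((*) n) \<subseteq> N" using assms N_mult_right by auto
  ultimately show ?thesis
    using right_ideal_cases[OF right_ideal_range[of n]] assms one_notin_N by blast
qed

text \<open>The choice depends only on the coset of \<open>x\<close>, so
  \<open>x = rep x + (x - rep x)\<close> splits \<open>x\<close> into a residue digit and a digit in
  \<open>N\<close>. No compatibility with the operations is imposed; \<open>rep 0\<close> may differ
  from 0.\<close>

definition rep :: "'r \<Rightarrow> 'r" where
  "rep x = (SOME y. y - x \<in> N)"

lemma rep_diff: "rep x - x \<in> N"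
  unfolding rep_def by (rule someI[of _ x]) simp

lemma diff_rep: "x - rep x \<in> N"
  using rep_diff N_diff_commute by blast

lemma rep_eq_iff: "rep x = rep y \<longleftrightarrow> x - y \<in> N"
proof
  assume "rep x = rep y"
  then show "x - y \<in> N" using N_diff[OF rep_diff[of y] rep_diff[of x]] by simp
next
  assume xy: "x - y \<in> N"
  have "z - x \<in> N \<longleftrightarrow> z - y \<in> N" for z
    using N_add[OF _ xy, of "z - x"] N_diff[OF _ xy, of "z - y"] by auto
  then show "rep x = rep y" by (simp add: rep_def)
qed

lemma rep_rep [simp]: "rep (rep x) = rep x"
  by (simp add: rep_eq_iff rep_diff)

lemma rep_mult_left [simp]: "rep (rep x * y) = rep (x * y)"
  using N_mult_right[OF rep_diff[of x], of y] by (simp add: rep_eq_iff algebra_simps)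

lemma rep_mult_right [simp]: "rep (x * rep y) = rep (x * y)"
  using N_mult_left[OF rep_diff[of y], of x] by (simp add: rep_eq_iff algebra_simps)

lemma rep_add_left [simp]: "rep (rep x + y) = rep (x + y)"
  using rep_diff[of x] by (simp add: rep_eq_iff)

lemma rep_add_right [simp]: "rep (x + rep y) = rep (x + y)"
  using rep_diff[of y] by (simp add: rep_eq_iff)

text \<open>Since \<open>N\<close> annihilates itself, left multiplication by an element of
  \<open>N\<close> sees only residues.\<close>

lemma mult_N_rep: "n \<in> N \<Longrightarrow> n * rep x = n * x"
  using N_mult_N[OF _ rep_diff[of x], of n] by (simp add: algebra_simps)

lemma rep_add_N: "n \<in> N \<Longrightarrow> rep (x + n) = rep x"
  by (simp add: rep_eq_iff)

lemma rep_range: "x \<in> range rep \<Longrightarrow> rep x = x"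
  by auto

lemma diff_range_rep: "x \<in> range rep \<Longrightarrow> y \<in> range rep \<Longrightarrow> x - y \<in> N \<Longrightarrow> x = y"
  by (metis rep_eq_iff rep_range)

lemma bij_betw_decompose:
  "bij_betw (\<lambda>x. (rep x, x - rep x)) UNIV (range rep \<times> N)"
proof (rule bij_betw_imageI)
  show "inj (\<lambda>x. (rep x, x - rep x))" by (rule injI) auto
  show "range (\<lambda>x. (rep x, x - rep x)) = range rep \<times> N"
  proof (intro equalityI subsetI)
    fix z assume "z \<in> range rep \<times> N"
    then obtain x n where z: "z = (rep x, n)" "n \<in> N" by auto
    then have "z = (rep (rep x + n), rep x + n - rep (rep x + n))"
      by (simp add: rep_eq_iff N_minus rep_add_N)
    then show "z \<in> range (\<lambda>x. (rep x, x - rep x))" by blast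
  qed (auto simp: diff_rep)
qed

lemma card_range_rep: "card (range rep) = q"
proof -
  have "q * card N = card (range rep) * card N"
    using bij_betw_same_card[OF bij_betw_decompose] card_UNIV_eq by (simp add: card_cartesian_product)
  moreover have "N \<noteq> {}" using N_zero by blast
  ultimately show ?thesis by simp
qed

text \<open>Multiplication by \<open>gen\<close> maps residue classes bijectively onto
  \<open>N\<close>: its kernel consists of elements of \<open>N\<close>, and its image is a nonzero
  right ideal inside \<open>N\<close>.\<close>

lemma card_N: "card N = q"
proof -
  have "bij_betw ((*) gen) (range rep) N"
  proof (rule bij_betw_imageI)
    show "inj_on ((*) gen) (range rep)"
    proof (rule inj_onI)
      fix x y assume xy: "x \<in> range rep" "y \<in> range rep" "gen * x = gen * y"
      then have "gen * (x - y) = 0" by (simp add: algebra_simps)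
      then have "x - y \<in> N" using annihilator_right gen by blast
      then show "x = y" using xy diff_range_rep by blast
    qed
    show "(*) gen ` range rep = N"
    proof -
      have "(*) gen ` range rep = range ((*) gen)"
        using mult_N_rep[OF gen(1)] by (simp add: image_image)
      then show ?thesis using N_eq_range gen by simp
    qed
  qed
  then show ?thesis using bij_betw_same_card card_range_rep by metis
qed

lemma q_ge_2: "q \<ge> 2"
proof -
  have "{0, gen} \<subseteq> N" using gen by simp
  then have "card {0, gen} \<le> card N" by (intro card_mono) auto
  then show ?thesis using gen by (simp add: card_N)
qed

section \<open>The residue ring and its commutativity\<close>

definition residue_ring :: "'r ring" where
  "residue_ring = \<lparr>carrier = range rep, mult = (\<lambda>x y. rep (x * y)), one = rep 1,
     zero = rep 0, add = (\<lambda>x y. rep (x + y))\<rparr>"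

lemma finite_division_ring_residue_ring: "finite_division_ring residue_ring"
proof -
  have ag: "abelian_group residue_ring"
  proof (rule abelian_groupI)
    fix x assume x: "x \<in> carrier residue_ring"
    then have "rep (- x) \<in> carrier residue_ring \<and> rep (- x) \<oplus>\<^bsub>residue_ring\<^esub> x = \<zero>\<^bsub>residue_ring\<^esub>"
      by (simp add: residue_ring_def)
    then show "\<exists>y\<in>carrier residue_ring. y \<oplus>\<^bsub>residue_ring\<^esub> x = \<zero>\<^bsub>residue_ring\<^esub>" by blast
  qed (auto simp: residue_ring_def add_ac)
  have mon: "Group.monoid residue_ring"
    by (rule monoidI) (auto simp: residue_ring_def mult.assoc)
  interpret ring residue_ring
    by (rule ringI[OF ag mon]) (auto simp: residue_ring_def algebra_simps)
  show ?thesis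
  proof (unfold_locales)
    show "finite (carrier residue_ring)" by simp
    show ne: "\<one>\<^bsub>residue_ring\<^esub> \<noteq> \<zero>\<^bsub>residue_ring\<^esub>"
      using one_notin_N by (simp add: residue_ring_def rep_eq_iff)
    show "Units residue_ring = carrier residue_ring - {\<zero>\<^bsub>residue_ring\<^esub>}"
    proof (intro equalityI subsetI)
      fix x assume "x \<in> Units residue_ring"
      then show "x \<in> carrier residue_ring - {\<zero>\<^bsub>residue_ring\<^esub>}"
        using ne by (auto simp: Units_def)
    next
      fix x assume x: "x \<in> carrier residue_ring - {\<zero>\<^bsub>residue_ring\<^esub>}"
      then have "rep x \<noteq> rep 0" by (auto simp: residue_ring_def)
      then have "x \<notin> N" by (simp add: rep_eq_iff)
      then obtain y where "x * y = 1" "y * x = 1" by (rule unit_if_notin_N)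
      then have "rep y \<in> carrier residue_ring" "rep y \<otimes>\<^bsub>residue_ring\<^esub> x = \<one>\<^bsub>residue_ring\<^esub>"
        "x \<otimes>\<^bsub>residue_ring\<^esub> rep y = \<one>\<^bsub>residue_ring\<^esub>"
        by (auto simp: residue_ring_def)
      then show "x \<in> Units residue_ring" using x by (auto simp: Units_def)
    qed
  qed
qed

lemma commutator_in_N: "x * y - y * x \<in> N"
proof -
  interpret finite_division_ring residue_ring by (rule finite_division_ring_residue_ring)
  have "rep x \<otimes>\<^bsub>residue_ring\<^esub> rep y = rep y \<otimes>\<^bsub>residue_ring\<^esub> rep x"
    by (rule wedderburn) (simp_all add: residue_ring_def)
  then show ?thesis by (simp add: residue_ring_def rep_eq_iff)
qed

text \<open>Subtracting the equations of two distinct roots \<open>u\<close>, \<open>v\<close> and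
  factoring, which is legitimate modulo \<open>N\<close> because commutators lie in
  \<open>N\<close>, gives that \<open>u + v\<close> is congruent to \<open>b\<close>. With three
  roots, the two partners of the first one would be congruent.\<close>

lemma quadratic_mod_N_roots:
  assumes S: "S \<subseteq> {x \<in> range rep. x * x - b * x - c \<in> N}"
  shows "card S \<le> 2"
proof (rule ccontr)
  assume "\<not> card S \<le> 2"
  then have "3 \<le> card S" by simp
  then obtain S' where "S' \<subseteq> S" "card S' = 3" by (meson obtain_subset_with_card_n)
  then obtain x y z where "x \<in> S" "y \<in> S" "z \<in> S" and ne: "x \<noteq> y" "x \<noteq> z" "y \<noteq> z"
    by (auto simp: card_3_iff)
  then have r: "x \<in> range rep" "y \<in> range rep" "z \<in> range rep"
    and p: "x * x - b * x - c \<in> N" "y * y - b * y - c \<in> N" "z * z - b * z - c \<in> N"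
    using S by auto
  have factor: "u + v - b \<in> N" if uv: "u \<in> range rep" "v \<in> range rep" "u \<noteq> v"
    "u * u - b * u - c \<in> N" "v * v - b * v - c \<in> N" for u v
  proof -
    have "(u + v - b) * (u - v) = (u * u - b * u - c) - (v * v - b * v - c) + (v * u - u * v)"
      by (simp add: algebra_simps)
    also have "\<dots> \<in> N" using N_add[OF N_diff[OF uv(4,5)] commutator_in_N] .
    finally have "(u + v - b) * (u - v) \<in> N" .
    moreover have "u - v \<notin> N" using uv diff_range_rep by blast
    ultimately show ?thesis using notin_N_mult_left by blast
  qed
  have "y - z \<in> N"
    using N_diff[OF factor[OF r(1,2) ne(1) p(1,2)] factor[OF r(1,3) ne(2) p(1,3)]]
    by simp
  with r ne diff_range_rep show False by blast
qed

end

section \<open>Points and lines\<close>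

definition cyclic_submodule :: "'r::ring_1 vec3 \<Rightarrow> 'r vec3 set" where
  "cyclic_submodule v = {vsmul v a | a. True}"

lemma vsmul_simp [simp]: "vsmul (x, y, z) a = (x * a, y * a, z * a)"
  by (simp add: vsmul_def)

lemma vadd_simp [simp]: "vadd (x, y, z) (x', y', z') = (x + x', y + y', z + z')"
  by (simp add: vadd_def)

lemma mem_cyclic_submodule: "v \<in> cyclic_submodule v"
  unfolding cyclic_submodule_def by (cases v) (auto intro!: exI[of _ 1])

lemma le_m_arc:
  assumes "proj_arc (K :: ('r::{ring_1,finite} vec3) set set) k n" shows "k \<le> m_arc TYPE('r) n"
  unfolding m_arc_def
proof (rule Max_ge)
  have "{k. \<exists>K::('r vec3) set set. proj_arc K k n} \<subseteq> {..card (UNIV :: ('r vec3) set set)}"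
    by (auto simp: proj_arc_def intro!: card_mono)
  then show "finite {k. \<exists>K::('r vec3) set set. proj_arc K k n}" using finite_subset by blast
  show "k \<in> {k. \<exists>K::('r vec3) set set. proj_arc K k n}" using assms by blast
qed

context chain_ring begin

text \<open>The first coordinate outside \<open>N\<close> is scaled to 1. The three disjuncts are
  the affine points, the infinite points with a slope, and the vertical infinite class.\<close>

definition normalized :: "'r vec3 \<Rightarrow> bool" where
  "normalized v \<longleftrightarrow> (\<exists>x y. v = (1, x, y)) \<or> (\<exists>n\<in>N. \<exists>y. v = (n, 1, y))
     \<or> (\<exists>n\<in>N. \<exists>m\<in>N. v = (n, m, 1))"

lemma cyclic_submodule_hpoint:
  assumes "normalized v" shows "cyclic_submodule v \<in> hpoints"
proof -
  have "\<forall>a. vsmul v a = vzero \<longrightarrow> a = 0" using assms by (auto simp: normalized_def vzero_def)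
  then show ?thesis unfolding hpoints_def cyclic_submodule_def by blast
qed

lemma normalized_unique:
  assumes v: "normalized v" and w: "normalized w" and "w \<in> cyclic_submodule v"
  shows "w = v"
proof -
  obtain a where a: "w = vsmul v a" using assms(3) by (auto simp: cyclic_submodule_def)
  have *: "b * a \<noteq> 1" if "b \<in> N \<or> a \<in> N" for b
    using that N_mult_left N_mult_right one_notin_N by metis
  consider x y where "v = (1, x, y)" | n y where "n \<in> N" "v = (n, 1, y)"
    | n m where "n \<in> N" "m \<in> N" "v = (n, m, 1)"
    using v unfolding normalized_def by blast
  then have "a = 1"
  proof cases
    case 1
    then show ?thesis using w a * unfolding normalized_def by auto
  next
    case 2
    then show ?thesis using w a * unfolding normalized_def by auto
  next
    case 3
    then show ?thesis using w a * unfolding normalized_def by auto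
  qed
  then show ?thesis using a by (cases v) simp
qed

text \<open>Passes from submodules to vectors: distinct normalized vectors generate distinct points,
  and a point inside a line has its generator there.\<close>

lemma proj_arc_cyclic_submodules:
  assumes V: "\<And>v. v \<in> V \<Longrightarrow> normalized v"
    and L: "\<And>L. L \<in> hlines \<Longrightarrow> card {v \<in> V. v \<in> L} \<le> n"
  shows "proj_arc (cyclic_submodule ` V) (card V) n"
  unfolding proj_arc_def
proof (intro conjI ballI)
  show "cyclic_submodule ` V \<subseteq> hpoints" using V cyclic_submodule_hpoint by blast
  have "inj_on cyclic_submodule V"
    by (rule inj_onI) (metis V normalized_unique mem_cyclic_submodule)
  then show "card (cyclic_submodule ` V) = card V" by (rule card_image)
  fix M :: "'r vec3 set" assume M: "M \<in> hlines"
  have "{P \<in> cyclic_submodule ` V. P \<subseteq> M} \<subseteq> cyclic_submodule ` {v \<in> V. v \<in> M}"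
    using mem_cyclic_submodule by blast
  then have "card {P \<in> cyclic_submodule ` V. P \<subseteq> M} \<le> card (cyclic_submodule ` {v \<in> V. v \<in> M})"
    by (intro card_mono) auto
  also have "\<dots> \<le> card {v \<in> V. v \<in> M}" by (rule card_image_le) simp
  also have "\<dots> \<le> n" using L[OF M] .
  finally show "card {P \<in> cyclic_submodule ` V. P \<subseteq> M} \<le> n" .
qed

section \<open>Lines and their linear equations\<close>

definition right_linear :: "('r vec3 \<Rightarrow> 'r) \<Rightarrow> bool" where
  "right_linear f \<longleftrightarrow> (\<forall>v w. f (vadd v w) = f v + f w) \<and> (\<forall>v a. f (vsmul v a) = f v * a)"

lemma right_linear_coordinates:
  "right_linear fst" "right_linear (fst \<circ> snd)" "right_linear (snd \<circ> snd)"
  by (auto simp: right_linear_def vadd_def vsmul_def)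

lemma right_linearD:
  assumes "right_linear f" shows "f (vadd v w) = f v + f w" "f (vsmul v a) = f v * a"
  using assms unfolding right_linear_def by blast+

definition span2 :: "'r vec3 \<Rightarrow> 'r vec3 \<Rightarrow> 'r vec3 set" where
  "span2 x y = {vadd (vsmul x a) (vsmul y b) | a b. True}"

lemma vadd_span2:
  assumes "v \<in> span2 x y" "w \<in> span2 x y" shows "vadd v w \<in> span2 x y"
proof -
  obtain a b c d where "v = vadd (vsmul x a) (vsmul y b)" "w = vadd (vsmul x c) (vsmul y d)"
    using assms by (auto simp: span2_def)
  then have "vadd v w = vadd (vsmul x (a + c)) (vsmul y (b + d))"
    by (cases x, cases y) (simp add: algebra_simps)
  then show ?thesis by (auto simp: span2_def)
qed

lemma vsmul_span2:
  assumes "v \<in> span2 x y" shows "vsmul v r \<in> span2 x y"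
proof -
  obtain a b where "v = vadd (vsmul x a) (vsmul y b)" using assms by (auto simp: span2_def)
  then have "vsmul v r = vadd (vsmul x (a * r)) (vsmul y (b * r))"
    by (cases x, cases y) (simp add: algebra_simps)
  then show ?thesis by (auto simp: span2_def)
qed

lemma card_span2:
  assumes "\<And>a b. vadd (vsmul x a) (vsmul y b) = vzero \<Longrightarrow> a = 0 \<and> b = 0"
  shows "card (span2 x y) = card (UNIV :: ('r \<times> 'r) set)"
proof -
  have "span2 x y = range (\<lambda>(a, b). vadd (vsmul x a) (vsmul y b))"
    unfolding span2_def by (auto simp: image_iff) blast
  moreover have "inj (\<lambda>(a, b). vadd (vsmul x a) (vsmul y b))"
  proof (rule injI, clarify)
    fix a b c d assume eq: "vadd (vsmul x a) (vsmul y b) = vadd (vsmul x c) (vsmul y d)"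
    have "vadd (vsmul x (a - c)) (vsmul y (b - d)) = vzero"
      using eq by (cases x, cases y) (simp add: vzero_def algebra_simps)
    then show "a = c \<and> b = d" using assms by fastforce
  qed
  ultimately show ?thesis by (simp add: card_image)
qed

text \<open>The pair \<open>f\<close>, \<open>g\<close> is injective on the span, hence by
  cardinality bijective onto all pairs; evaluating \<open>h\<close> at the preimages of
  \<open>(1, 0)\<close> and \<open>(0, 1)\<close> gives the left coefficients. The three functionals
  are kept general so that any coordinate can be solved for.\<close>

lemma linear_relation_of_projection:
  assumes lin: "right_linear f" "right_linear g" "right_linear h"
    and card: "card (span2 x y) = card (UNIV :: ('r \<times> 'r) set)"
    and ker: "\<And>v. v \<in> span2 x y \<Longrightarrow> f v = 0 \<Longrightarrow> g v = 0 \<Longrightarrow> v = vzero"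
  obtains c s where "\<And>v. v \<in> span2 x y \<Longrightarrow> h v = c * f v + s * g v"
proof -
  let ?M = "span2 x y"
  have minus: "f (vadd v (vsmul w (- 1))) = f v - f w" if "right_linear f" for f v w
    using that by (simp add: right_linearD)
  have inj: "inj_on (\<lambda>v. (f v, g v)) ?M"
  proof (rule inj_onI)
    fix v w assume vw: "v \<in> ?M" "w \<in> ?M" "(f v, g v) = (f w, g w)"
    have "vadd v (vsmul w (- 1)) \<in> ?M" using vw vadd_span2 vsmul_span2 by blast
    then have "vadd v (vsmul w (- 1)) = vzero" using vw(3)
      by (intro ker) (simp_all add: minus[OF lin(1)] minus[OF lin(2)])
    then show "v = w" by (cases v, cases w) (simp add: vzero_def)
  qed
  then have surj: "(\<lambda>v. (f v, g v)) ` ?M = UNIV"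
    using card by (intro card_eq_UNIV_imp_eq_UNIV) (auto simp: card_image)
  have "(1, 0) \<in> (\<lambda>v. (f v, g v)) ` ?M" using surj by blast
  then obtain e1 where e1: "e1 \<in> ?M" "f e1 = 1" "g e1 = 0" by auto
  have "(0, 1) \<in> (\<lambda>v. (f v, g v)) ` ?M" using surj by blast
  then obtain e2 where e2: "e2 \<in> ?M" "f e2 = 0" "g e2 = 1" by auto
  show thesis
  proof (rule that[of "h e1" "h e2"])
    fix v assume v: "v \<in> ?M"
    let ?w = "vadd (vsmul e1 (f v)) (vsmul e2 (g v))"
    have "?w \<in> ?M" using e1 e2 vadd_span2 vsmul_span2 by blast
    moreover have "(f ?w, g ?w) = (f v, g v)"
      using lin e1 e2 by (simp add: right_linearD)
    ultimately have "?w = v" using inj v by (meson inj_onD)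
    then have "h v = h ?w" by simp
    then show "h v = h e1 * f v + h e2 * g v" using lin by (simp add: right_linearD)
  qed
qed

lemma N_subset_multiples:
  assumes "w \<noteq> 0" "m \<in> N" obtains r where "w * r = m"
proof (cases "w \<in> N")
  case True
  then have "m \<in> range ((*) w)" using N_eq_range assms by blast
  then show ?thesis using that by blast
next
  case False
  then obtain y where "w * y = 1" by (rule unit_if_notin_N)
  then show ?thesis using that[of "y * m"] by (simp flip: mult.assoc)
qed

text \<open>If the line contains no nonzero vector of some coordinate axis, that coordinate is a
  linear function of the other two. If it meets all three axes, it contains
  \<open>N \<times> N \<times> N\<close>, too large a set to come from coefficient pairs in
  \<open>N \<times> N\<close>. The axes are tested in a fixed order, which puts the stated
  coefficients of the later cases into \<open>N\<close>. An inclusion is enough for bounding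
  intersections from above.\<close>

lemma hline_cases:
  assumes "M \<in> hlines"
  obtains s c where "M \<subseteq> {(u, v, w). w = s * v + c * u}"
  | a \<nu> where "\<nu> \<in> N" "M \<subseteq> {(u, v, w). v = a * u + \<nu> * w}"
  | \<nu> \<mu> where "\<nu> \<in> N" "\<mu> \<in> N" "M \<subseteq> {(u, v, w). u = \<nu> * v + \<mu> * w}"
proof -
  obtain x y where M: "M = span2 x y"
    and ind: "\<And>a b. vadd (vsmul x a) (vsmul y b) = vzero \<Longrightarrow> a = 0 \<and> b = 0"
    using assms unfolding hlines_def span2_def by blast
  note card = card_span2[of x y, OF ind]
  note lin = right_linear_coordinates
  show thesis
  proof (cases "\<exists>w. w \<noteq> 0 \<and> (0, 0, w) \<in> M")
    case False
    then obtain c s where "\<And>v. v \<in> span2 x y \<Longrightarrow> (snd \<circ> snd) v = c * fst v + s * (fst \<circ> snd) v"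
      using linear_relation_of_projection[OF lin(1,2,3) card] unfolding M vzero_def
      by (metis comp_apply prod.collapse)
    then have "M \<subseteq> {(u, v, w). w = s * v + c * u}" unfolding M by (fastforce simp: add.commute)
    then show thesis by (rule that(1))
  next
    case True
    then obtain w where "w \<noteq> 0" "(0, 0, w) \<in> M" by blast
    have n3: "(0, 0, m) \<in> M" if "m \<in> N" for m
    proof -
      obtain r where "w * r = m" using N_subset_multiples[OF \<open>w \<noteq> 0\<close> \<open>m \<in> N\<close>] by blast
      then have "(0, 0, m) = vsmul (0, 0, w) r" by simp
      then show ?thesis using \<open>(0, 0, w) \<in> M\<close> vsmul_span2 unfolding M by metis
    qed
    show thesis
    proof (cases "\<exists>w. w \<noteq> 0 \<and> (0, w, 0) \<in> M")
      case False
      then obtain c s where cs: "\<And>v. v \<in> span2 x y \<Longrightarrow> (fst \<circ> snd) v = c * fst v + s * (snd \<circ> snd) v"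
        using linear_relation_of_projection[OF lin(1,3,2) card] unfolding M vzero_def
        by (metis comp_apply prod.collapse)
      then have sub: "M \<subseteq> {(u, v, w). v = c * u + s * w}" unfolding M by fastforce
      \<comment> \<open>The vector \<open>(0, 0, gen)\<close> lies in \<open>M\<close>, so the
        equation forces \<open>s\<close> to annihilate \<open>gen\<close>.\<close>
      have "s * gen = 0" using sub n3[OF gen(1)] by auto
      then have "s \<in> N" using annihilator_left gen by blast
      then show thesis using sub by (rule that(2))
    next
      case True
      then obtain w where "w \<noteq> 0" "(0, w, 0) \<in> M" by blast
      have n2: "(0, m, 0) \<in> M" if "m \<in> N" for m
      proof -
        obtain r where "w * r = m" using N_subset_multiples[OF \<open>w \<noteq> 0\<close> \<open>m \<in> N\<close>] by blast
        then have "(0, m, 0) = vsmul (0, w, 0) r" by simp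
        then show ?thesis using \<open>(0, w, 0) \<in> M\<close> vsmul_span2 unfolding M by metis
      qed
      show thesis
      proof (cases "\<exists>w. w \<noteq> 0 \<and> (w, 0, 0) \<in> M")
        case False
        then obtain c s where cs: "\<And>v. v \<in> span2 x y \<Longrightarrow> fst v = c * (fst \<circ> snd) v + s * (snd \<circ> snd) v"
          using linear_relation_of_projection[OF lin(2,3,1) card] unfolding M vzero_def
          by (metis comp_apply prod.collapse)
        then have sub: "M \<subseteq> {(u, v, w). u = c * v + s * w}" unfolding M by fastforce
        have "s * gen = 0" "c * gen = 0" using sub n3[OF gen(1)] n2[OF gen(1)] by auto
        then have "s \<in> N" "c \<in> N" using annihilator_left gen by blast+
        then show thesis using sub that(3) by blast
      next
        case True
        then obtain w where "w \<noteq> 0" "(w, 0, 0) \<in> M" by blast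
        have n1: "(m, 0, 0) \<in> M" if "m \<in> N" for m
        proof -
          obtain r where "w * r = m" using N_subset_multiples[OF \<open>w \<noteq> 0\<close> \<open>m \<in> N\<close>] by blast
          then have "(m, 0, 0) = vsmul (w, 0, 0) r" by simp
          then show ?thesis using \<open>(w, 0, 0) \<in> M\<close> vsmul_span2 unfolding M by metis
        qed
        have "N \<times> N \<times> N \<subseteq> (\<lambda>(a, b). vadd (vsmul x a) (vsmul y b)) ` (N \<times> N)"
        proof
          fix z assume z: "z \<in> N \<times> N \<times> N"
          then obtain i j k where ijk: "z = (i, j, k)" "i \<in> N" "j \<in> N" "k \<in> N" by auto
          have "z = vadd (i, 0, 0) (vadd (0, j, 0) (0, 0, k))" by (simp add: ijk)
          then have "z \<in> M" using ijk n1 n2 n3 vadd_span2 unfolding M by metis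
          then obtain a b where ab: "z = vadd (vsmul x a) (vsmul y b)" by (auto simp: M span2_def)
          \<comment> \<open>Multiplying by \<open>gen\<close> kills \<open>z\<close>, so
            independence makes \<open>gen\<close> kill both coefficients, which are therefore in
            \<open>N\<close>.\<close>
          have "vsmul z gen = vzero" using ijk gen by (simp add: vzero_def N_mult_N)
          then have "vadd (vsmul x (a * gen)) (vsmul y (b * gen)) = vzero"
            unfolding ab by (cases x, cases y) (simp add: algebra_simps)
          then have "a * gen = 0" "b * gen = 0" using ind by blast+
          then have "a \<in> N" "b \<in> N" using annihilator_left gen by blast+
          then show "z \<in> (\<lambda>(a, b). vadd (vsmul x a) (vsmul y b)) ` (N \<times> N)"
            using ab by (intro image_eqI[of _ _ "(a, b)"]) auto
        qed
        then have "card (N \<times> N \<times> N) \<le> card (N \<times> N)" by (rule surj_card_le[rotated]) simp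
        then show thesis using q_ge_2 by (simp add: card_cartesian_product card_N)
      qed
    qed
  qed
qed

section \<open>The arc\<close>

lemma card_decompose:
  assumes "J \<subseteq> range rep" "D \<subseteq> N"
  shows "card {x. rep x \<in> J \<and> x - rep x \<in> D} = card J * card D"
proof -
  let ?f = "\<lambda>x. (rep x, x - rep x)"
  have "inj ?f" "range ?f = range rep \<times> N" using bij_betw_decompose by (auto simp only: bij_betw_def)
  then have "card (?f -` (J \<times> D)) = card (J \<times> D)" using assms by (intro card_vimage_inj) auto
  moreover have "?f -` (J \<times> D) = {x. rep x \<in> J \<and> x - rep x \<in> D}" by auto
  ultimately show ?thesis by (simp add: card_cartesian_product)
qed

lemma card_rep_in: "J \<subseteq> range rep \<Longrightarrow> card {x. rep x \<in> J} = card J * q"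
  using card_decompose[of J N] by (simp add: diff_rep card_N)

text \<open>The label \<open>\<xi>\<close> of a column also serves as its slope, so that no two columns share a slope.\<close>
definition double_columns :: "'r set \<Rightarrow> ('r \<times> 'r) set" where
  "double_columns J = {(x, y). rep x \<in> J \<and> (y - rep y) - rep x * (x - rep x) \<in> {0, gen}}"

text \<open>The quadratic shift turns the vertical segments of a column into a dual conic: a vertical line
  contains the segment of the class of \<open>y\<close> iff \<open>y\<close> is a root of a quadratic polynomial modulo \<open>N\<close>.\<close>
definition conic_columns :: "'r set \<Rightarrow> ('r \<times> 'r) set" where
  "conic_columns J = {(x, y). rep x \<in> J \<and> x - rep x = gen * (y * y)}"

text \<open>The residue of \<open>y\<close> is the slope labelling the infinite class, and fixing
  \<open>n\<close> selects one segment of it. The same segments \<open>W\<close> are used in every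
  class of \<open>I\<close>; a sloped line has at most one point on each segment of the class of its
  slope.\<close>

definition infinite_segments :: "'r set \<Rightarrow> 'r set \<Rightarrow> ('r \<times> 'r) set" where
  "infinite_segments I W = {(n, y). n \<in> W \<and> rep y \<in> I}"

lemma card_double_columns:
  assumes "J \<subseteq> range rep" shows "card (double_columns J) = 2 * q\<^sup>2 * card J"
proof -
  have "double_columns J = (SIGMA x:{x. rep x \<in> J}. {y. rep y \<in> range rep \<and>
      y - rep y \<in> {rep x * (x - rep x), rep x * (x - rep x) + gen}})"
    by (auto simp: double_columns_def algebra_simps)
  moreover have "card {y. rep y \<in> range rep \<and>
      y - rep y \<in> {rep x * (x - rep x), rep x * (x - rep x) + gen}} = 2 * q" for x
    using gen diff_rep N_mult_left N_add by (subst card_decompose) (auto simp: card_range_rep)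
  ultimately show ?thesis
    by (simp add: card_rep_in[OF assms] power2_eq_square del: insert_iff)
qed

text \<open>Ensures that the shift in \<open>conic_columns\<close> is constant on each neighbour
  class.\<close>

lemma gen_square_cong:
  assumes "rep x = rep y" shows "gen * (x * x) = gen * (y * y)"
proof -
  have "rep (x * x) = rep (rep x * rep x)" "rep (y * y) = rep (rep y * rep y)" by simp_all
  then have "rep (x * x) = rep (y * y)" by (simp only: assms)
  then show ?thesis using mult_N_rep[OF gen(1)] by metis
qed

lemma card_UNIV_square: "card (UNIV :: 'r set) = q\<^sup>2"
  by (simp add: card_UNIV_eq card_N power2_eq_square)

lemma card_conic_columns:
  assumes "J \<subseteq> range rep" shows "card (conic_columns J) = q\<^sup>2 * card J"
proof -
  have "conic_columns J = prod.swap `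
      (SIGMA y:UNIV. {x. rep x \<in> J \<and> x - rep x \<in> {gen * (y * y)}})"
    by (auto simp: conic_columns_def image_iff)
  moreover have "card {x. rep x \<in> J \<and> x - rep x \<in> {gen * (y * y)}} = card J" for y
    using assms gen N_mult_right by (subst card_decompose) auto
  ultimately show ?thesis
    by (simp add: card_image card_UNIV_square)
qed

lemma card_infinite_segments:
  assumes "I \<subseteq> range rep" shows "card (infinite_segments I W) = card W * (card I * q)"
proof -
  have "infinite_segments I W = W \<times> {y. rep y \<in> I}" by (auto simp: infinite_segments_def)
  then show ?thesis by (simp add: card_cartesian_product card_rep_in[OF assms])
qed

text \<open>Inside the column \<open>\<xi>\<close>, the value tested for membership in
  \<open>{0, gen}\<close> varies with \<open>x\<close> as \<open>(s - \<xi>) * x\<close>. If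
  \<open>s\<close> and \<open>\<xi>\<close> have different residues the factor is a unit and at most
  two points survive; otherwise the trivial bound \<open>q = 2 + (q - 2)\<close> is used, and this
  affects a single column.\<close>

lemma double_columns_sloped_line:
  assumes J: "J \<subseteq> range rep"
  shows "card {(x, y) \<in> double_columns J. y = s * x + c} \<le> 2 * card J + (if rep s \<in> J then q - 2 else 0)"
proof -
  define val where "val x = (s * x + c - rep (s * x + c)) - rep x * (x - rep x)" for x
  define X where "X \<xi> = {x. rep x = \<xi> \<and> val x \<in> {0, gen}}" for \<xi>
  have le: "card (X \<xi>) \<le> 2 + (if rep s = \<xi> then q - 2 else 0)" if "\<xi> \<in> J" for \<xi>
  proof (cases "rep s = \<xi>")
    case True
    have "card (X \<xi>) \<le> card {x. rep x \<in> {\<xi>}}" by (rule card_mono) (auto simp: X_def)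
    also have "\<dots> = q" using card_rep_in[of "{\<xi>}"] J that by auto
    finally show ?thesis using True q_ge_2 by simp
  next
    case False
    have "inj_on val (X \<xi>)"
    proof (rule inj_onI)
      fix x x' assume x: "x \<in> X \<xi>" "x' \<in> X \<xi>" and eq: "val x = val x'"
      have "rep x = rep x'" using x by (simp add: X_def)
      then have "x - x' \<in> N" by (simp add: rep_eq_iff)
      then have "rep (s * x + c) = rep (s * x' + c)"
        using N_mult_left[of "x - x'" s] by (simp add: rep_eq_iff algebra_simps)
      then have "(s - \<xi>) * (x - x') = 0" using eq x by (simp add: val_def X_def algebra_simps)
      moreover have "s - \<xi> \<notin> N" using False J that by (metis rep_eq_iff rep_range subsetD)
      ultimately show "x = x'" using annihilator_left[of "x - x'" "s - \<xi>"] by auto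
    qed
    then have "card (X \<xi>) \<le> card {0, gen}" by (rule card_inj_on_le) (auto simp: X_def)
    then show ?thesis using gen False by simp
  qed
  have "{(x, y) \<in> double_columns J. y = s * x + c} \<subseteq> (\<lambda>x. (x, s * x + c)) ` (\<Union>\<xi>\<in>J. X \<xi>)"
    by (auto simp: double_columns_def X_def val_def)
  then have "card {(x, y) \<in> double_columns J. y = s * x + c} \<le> card (\<Union>\<xi>\<in>J. X \<xi>)"
    by (rule surj_card_le[rotated]) simp
  also have "\<dots> \<le> (\<Sum>\<xi>\<in>J. card (X \<xi>))" by (rule card_UN_le) simp
  also have "\<dots> \<le> (\<Sum>\<xi>\<in>J. 2 + (if rep s = \<xi> then q - 2 else 0))" by (rule sum_mono) (rule le)
  also have "\<dots> = 2 * card J + (if rep s \<in> J then q - 2 else 0)"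
    by (subst sum.distrib) simp
  finally show ?thesis .
qed

text \<open>On the line the residue of \<open>x\<close> determines that of \<open>y\<close>, hence
  the shift \<open>gen * (y * y)\<close>, hence \<open>x\<close> itself: each column contributes at
  most one point.\<close>

lemma conic_columns_sloped_line:
  "card {(x, y) \<in> conic_columns J. y = s * x + c} \<le> card J"
proof (rule card_inj_on_le)
  show "inj_on (rep \<circ> fst) {(x, y) \<in> conic_columns J. y = s * x + c}"
  proof (rule inj_onI)
    fix p p' assume "p \<in> {(x, y) \<in> conic_columns J. y = s * x + c}"
      "p' \<in> {(x, y) \<in> conic_columns J. y = s * x + c}" "(rep \<circ> fst) p = (rep \<circ> fst) p'"
    then obtain x x' where p: "p = (x, s * x + c)" "p' = (x', s * x' + c)"
      and *: "(x, s * x + c) \<in> conic_columns J" "(x', s * x' + c) \<in> conic_columns J"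
        "rep x = rep x'" by auto
    have "x - x' \<in> N" using *(3) by (simp add: rep_eq_iff)
    then have "rep (s * x + c) = rep (s * x' + c)"
      using N_mult_left[of "x - x'" s] by (simp add: rep_eq_iff algebra_simps)
    then have "gen * ((s * x + c) * (s * x + c)) = gen * ((s * x' + c) * (s * x' + c))"
      by (rule gen_square_cong)
    then have "x - rep x = x' - rep x'" using *(1,2) by (simp add: conic_columns_def)
    then show "p = p'" using *(3) p by simp
  qed
qed (auto simp: conic_columns_def)

lemma infinite_segments_sloped_line:
  "card {(n, y) \<in> infinite_segments I W. y = s + c * n} \<le> (if rep s \<in> I then card W else 0)"
  if "W \<subseteq> N"
proof -
  have "{(n, y) \<in> infinite_segments I W. y = s + c * n} \<subseteq> (\<lambda>n. (n, s + c * n)) ` (if rep s \<in> I then W else {})"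
    using that rep_add_N[OF N_mult_left] by (auto simp: infinite_segments_def)
  then have "card {(n, y) \<in> infinite_segments I W. y = s + c * n} \<le> card (if rep s \<in> I then W else {})"
    by (rule surj_card_le[rotated]) simp
  then show ?thesis by (simp split: if_splits)
qed

text \<open>The line stays in the column of \<open>rep a\<close>, and there \<open>x\<close> depends
  only on the residue of \<open>y\<close>. Each of the \<open>q\<close> residues thus leaves two
  values for the \<open>N\<close>-part of \<open>y\<close>.\<close>

lemma double_columns_vertical_line:
  assumes "\<nu> \<in> N"
  shows "card {(x, y) \<in> double_columns J. x = a + \<nu> * y} \<le> (if rep a \<in> J then 2 * q else 0)"
proof (cases "rep a \<in> J")
  case True
  define val where "val y = (y - rep y) - rep a * (a + \<nu> * y - rep a)" for y
  have "card {y. val y \<in> {0, gen}} \<le> card (range rep \<times> {0, gen})"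
  proof (rule card_inj_on_le)
    show "inj_on (\<lambda>y. (rep y, val y)) {y. val y \<in> {0, gen}}"
    proof (rule inj_onI)
      fix y y' assume "(rep y, val y) = (rep y', val y')"
      then have eq: "rep y = rep y'" "val y = val y'" by auto
      have "\<nu> * y = \<nu> * y'" using mult_N_rep[OF assms] eq(1) by metis
      then show "y = y'" using eq by (simp add: val_def)
    qed
  qed auto
  also have "\<dots> = 2 * q" using gen by (simp add: card_cartesian_product card_range_rep)
  finally have le: "card {y. val y \<in> {0, gen}} \<le> 2 * q" .
  have "{(x, y) \<in> double_columns J. x = a + \<nu> * y} \<subseteq> (\<lambda>y. (a + \<nu> * y, y)) ` {y. val y \<in> {0, gen}}"
    using rep_add_N[OF N_mult_right[OF assms]] by (auto simp: double_columns_def val_def)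
  then have "card {(x, y) \<in> double_columns J. x = a + \<nu> * y} \<le> card {y. val y \<in> {0, gen}}"
    by (rule surj_card_le[rotated]) simp
  with le True show ?thesis by simp
next
  case False
  then have "{(x, y) \<in> double_columns J. x = a + \<nu> * y} = {}"
    using rep_add_N[OF N_mult_right[OF assms]] by (auto simp: double_columns_def)
  then show ?thesis by (simp only: card.empty le0)
qed

text \<open>Writing \<open>\<nu> = gen * b\<close> and \<open>a - rep a = gen * c\<close> and
  cancelling \<open>gen\<close> turns incidence into \<open>y * y - b * y - c \<in> N\<close>; at
  most two residues solve this, each with \<open>q\<close> lifts.\<close>

lemma conic_columns_vertical_line:
  assumes "\<nu> \<in> N"
  shows "card {(x, y) \<in> conic_columns J. x = a + \<nu> * y} \<le> (if rep a \<in> J then 2 * q else 0)"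
proof (cases "rep a \<in> J")
  case True
  obtain b where b: "\<nu> = gen * b" using assms N_eq_range[OF gen] by blast
  obtain c where c: "a - rep a = gen * c" using diff_rep[of a] N_eq_range[OF gen] by blast
  define S where "S = {\<eta> \<in> range rep. \<eta> * \<eta> - b * \<eta> - c \<in> N}"
  have root: "rep y \<in> S" if "a + \<nu> * y - rep a = gen * (y * y)" for y
  proof -
    have "gen * (rep y * rep y) = gen * (y * y)" by (rule gen_square_cong) simp
    moreover have "\<nu> * rep y = \<nu> * y" by (rule mult_N_rep[OF assms])
    moreover have "gen * (rep y * rep y - b * rep y - c)
        = gen * (rep y * rep y) - \<nu> * rep y - (a - rep a)"
      unfolding b c by (simp add: algebra_simps)
    ultimately have "gen * (rep y * rep y - b * rep y - c) = 0"
      using that by (simp add: algebra_simps)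
    then show ?thesis using annihilator_right gen by (auto simp: S_def)
  qed
  have "card {y. rep y \<in> S} = card S * q" by (rule card_rep_in) (auto simp: S_def)
  also have "\<dots> \<le> 2 * q" using quadratic_mod_N_roots[of S b c] by (simp add: S_def)
  finally have le: "card {y. rep y \<in> S} \<le> 2 * q" .
  have "{(x, y) \<in> conic_columns J. x = a + \<nu> * y} \<subseteq> (\<lambda>y. (a + \<nu> * y, y)) ` {y. rep y \<in> S}"
    using root rep_add_N[OF N_mult_right[OF assms]] by (auto simp: conic_columns_def)
  then have "card {(x, y) \<in> conic_columns J. x = a + \<nu> * y} \<le> card {y. rep y \<in> S}"
    by (rule surj_card_le[rotated]) simp
  with le True show ?thesis by simp
next
  case False
  then have "{(x, y) \<in> conic_columns J. x = a + \<nu> * y} = {}"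
    using rep_add_N[OF N_mult_right[OF assms]] by (auto simp: conic_columns_def)
  then show ?thesis by (simp only: card.empty le0)
qed

lemma infinite_segments_line_at_infinity:
  assumes "I \<subseteq> range rep"
  shows "card {(n, y) \<in> infinite_segments I W. n = \<nu> + \<mu> * y} \<le> q * card I"
proof -
  have "{(n, y) \<in> infinite_segments I W. n = \<nu> + \<mu> * y} \<subseteq> (\<lambda>y. (\<nu> + \<mu> * y, y)) ` {y. rep y \<in> I}"
    by (auto simp: infinite_segments_def)
  then have "card {(n, y) \<in> infinite_segments I W. n = \<nu> + \<mu> * y} \<le> card {y. rep y \<in> I}"
    by (rule surj_card_le[rotated]) simp
  then show ?thesis using card_rep_in[OF assms] by (simp add: mult.commute)
qed

text \<open>\<open>J2\<close> labels the double columns, \<open>J1\<close> the conic columns,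
  \<open>I\<close> the slopes receiving infinite segments, and \<open>C\<close> is the part in the
  vertical infinite class. The last three assumptions are the budgets for the three kinds of lines
  in \<open>hline_cases\<close>. Disjointness of \<open>I\<close> and \<open>J2\<close> ensures that
  a sloped line draws its surplus of up to \<open>q - 2\<close> points from one source only.\<close>

lemma proj_arc_construction:
  assumes J: "J1 \<subseteq> range rep" "J2 \<subseteq> range rep" "J1 \<inter> J2 = {}"
    and I: "I \<subseteq> range rep" "I \<inter> J2 = {}"
    and W: "W \<subseteq> N" "card W \<le> q - 2"
    and C: "C \<subseteq> N \<times> N"
    and sloped: "2 * card J2 + card J1 + (q - 2) \<le> n"
    and vertical: "\<And>a \<nu>. \<nu> \<in> N \<Longrightarrow>
      card {(x, y) \<in> C. y = a * x + \<nu>} + (if rep a \<in> J1 \<union> J2 then 2 * q else 0) \<le> n"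
    and infinite: "\<And>\<mu>. card {(x, y) \<in> C. x = \<mu>} + q * card I \<le> n"
  shows "\<exists>K :: 'r vec3 set set.
    proj_arc K (2 * q\<^sup>2 * card J2 + q\<^sup>2 * card J1 + card W * (card I * q) + card C) n"
proof -
  define A where "A = double_columns J2 \<union> conic_columns J1"
  define B where "B = infinite_segments I W"
  define fA where "fA = (\<lambda>(x, y). (1 :: 'r, x, y) :: 'r vec3)"
  define fB where "fB = (\<lambda>(n, y). (n, 1 :: 'r, y) :: 'r vec3)"
  define fC where "fC = (\<lambda>(n, m). (n, m, 1 :: 'r) :: 'r vec3)"
  define V where "V = fA ` A \<union> fB ` B \<union> fC ` C"
  have normal: "normalized v" if "v \<in> V" for v
    using that W C by (auto simp: V_def fA_def fB_def fC_def B_def infinite_segments_def normalized_def)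
  have inj: "card (fA ` X) = card X" "card (fB ` X) = card X" "card (fC ` X) = card X" for X
    by (auto simp: fA_def fB_def fC_def inj_on_def intro!: card_image)
  have "card V = card (fA ` A) + card (fB ` B) + card (fC ` C)"
  proof -
    have "fA ` A \<inter> fB ` B = {}" "(fA ` A \<union> fB ` B) \<inter> fC ` C = {}"
      using W C one_notin_N by (auto simp: fA_def fB_def fC_def B_def infinite_segments_def)
    then show ?thesis by (simp add: V_def card_Un_disjoint)
  qed
  also have "\<dots> = card A + card B + card C"
    by (simp only: inj)
  also have "card A = card (double_columns J2) + card (conic_columns J1)"
    unfolding A_def using J(3) by (intro card_Un_disjoint) (auto simp: double_columns_def conic_columns_def)
  finally have cardV: "card V = 2 * q\<^sup>2 * card J2 + q\<^sup>2 * card J1 + card W * (card I * q) + card C"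
    using card_double_columns card_conic_columns card_infinite_segments J I by (simp add: B_def)
  have split: "card {v \<in> V. v \<in> M} \<le> card {(x, y) \<in> A. (1, x, y) \<in> M}
      + card {(n, y) \<in> B. (n, 1, y) \<in> M} + card {(n, m) \<in> C. (n, m, 1) \<in> M}" for M
  proof -
    let ?A = "{(x, y) \<in> A. (1, x, y) \<in> M}" and ?B = "{(n, y) \<in> B. (n, 1, y) \<in> M}"
      and ?C = "{(n, m) \<in> C. (n, m, 1) \<in> M}"
    have eq: "{v \<in> V. v \<in> M} = fA ` ?A \<union> fB ` ?B \<union> fC ` ?C"
      by (auto simp: V_def fA_def fB_def fC_def)
    have "card (fA ` ?A \<union> fB ` ?B \<union> fC ` ?C) \<le> card (fA ` ?A \<union> fB ` ?B) + card (fC ` ?C)"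
      by (rule card_Un_le)
    moreover have "card (fA ` ?A \<union> fB ` ?B) \<le> card (fA ` ?A) + card (fB ` ?B)"
      by (rule card_Un_le)
    ultimately show ?thesis unfolding eq inj[of ?A] inj[of ?B] inj[of ?C] by linarith
  qed
  have splitA: "card {(x, y) \<in> A. P x y} \<le> card {(x, y) \<in> double_columns J2. P x y}
      + card {(x, y) \<in> conic_columns J1. P x y}" for P
  proof -
    have "{(x, y) \<in> A. P x y} = {(x, y) \<in> double_columns J2. P x y} \<union> {(x, y) \<in> conic_columns J1. P x y}"
      by (auto simp: A_def)
    then show ?thesis by (simp add: card_Un_le)
  qed
  have empty: "card {(x, y) \<in> D. Q x y} \<le> 0" if "\<And>x y. (x, y) \<in> D \<Longrightarrow> \<not> Q x y" for D :: "('r \<times> 'r) set" and Q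
  proof -
    have "{(x, y) \<in> D. Q x y} = {}" using that by blast
    then show ?thesis by (simp only: card.empty le0)
  qed
  have B_N: "x \<in> N" if "(x, y) \<in> B" for x y using that W by (auto simp: B_def infinite_segments_def)
  have lines: "card {v \<in> V. v \<in> M} \<le> n" if "M \<in> hlines" for M
    using that
  proof (cases rule: hline_cases)
    case (1 s c)
    have "card {(x, y) \<in> A. (1, x, y) \<in> M} \<le> card {(x, y) \<in> A. y = s * x + c}"
      using 1 by (intro card_mono) auto
    also note splitA
    also note add_mono[OF double_columns_sloped_line[OF J(2)] conic_columns_sloped_line]
    finally have a: "card {(x, y) \<in> A. (1, x, y) \<in> M} \<le>
      2 * card J2 + (if rep s \<in> J2 then q - 2 else 0) + card J1" .
    have "card {(n, y) \<in> B. (n, 1, y) \<in> M} \<le> card {(n, y) \<in> B. y = s + c * n}"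
      using 1 by (intro card_mono) auto
    also have "\<dots> \<le> (if rep s \<in> I then card W else 0)"
      unfolding B_def by (rule infinite_segments_sloped_line[OF W(1)])
    finally have b: "card {(n, y) \<in> B. (n, 1, y) \<in> M} \<le> (if rep s \<in> I then card W else 0)" .
    \<comment> \<open>On a sloped line such a point would express 1 by elements of \<open>N\<close>;
      the same contradiction clears the infinite points with a slope in the second case and the
      affine points in the third.\<close>
    have "(x, y, 1) \<notin> M" if "(x, y) \<in> C" for x y
    proof
      assume "(x, y, 1) \<in> M"
      then have "1 = s * y + c * x" using 1 by auto
      then show False using one_notin_N N_add N_mult_left C that by (metis SigmaD1 SigmaD2 subsetD)
    qed
    then have "card {(n, m) \<in> C. (n, m, 1) \<in> M} \<le> 0" by (rule empty)
    \<comment> \<open>The residue of \<open>s\<close> lies in at most one of \<open>J2\<close> and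
      \<open>I\<close>, so the two surpluses never add up.\<close>
    moreover have "(if rep s \<in> J2 then q - 2 else 0) + (if rep s \<in> I then card W else 0) \<le> q - 2"
      using W(2) I(2) by auto
    ultimately show ?thesis using split[of M] a b sloped by linarith
  next
    case (2 a \<nu>)
    have "card {(x, y) \<in> A. (1, x, y) \<in> M} \<le> card {(x, y) \<in> A. x = a + \<nu> * y}"
      using 2 by (intro card_mono) auto
    also note splitA
    also note add_mono[OF double_columns_vertical_line[OF 2(1)] conic_columns_vertical_line[OF 2(1)]]
    finally have a: "card {(x, y) \<in> A. (1, x, y) \<in> M} \<le>
      (if rep a \<in> J2 then 2 * q else 0) + (if rep a \<in> J1 then 2 * q else 0)" .
    have "(x, 1, y) \<notin> M" if "(x, y) \<in> B" for x y
    proof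
      assume "(x, 1, y) \<in> M"
      then have "1 = a * x + \<nu> * y" using 2 by auto
      then show False using one_notin_N N_add N_mult_left N_mult_right B_N[OF that] 2(1) by metis
    qed
    then have b: "card {(n, y) \<in> B. (n, 1, y) \<in> M} \<le> 0" by (rule empty)
    have "card {(n, m) \<in> C. (n, m, 1) \<in> M} \<le> card {(x, y) \<in> C. y = a * x + \<nu>}"
      using 2 by (intro card_mono) auto
    moreover have "(if rep a \<in> J2 then 2 * q else 0) + (if rep a \<in> J1 then 2 * q else 0)
        \<le> (if rep a \<in> J1 \<union> J2 then 2 * q else 0)" using J(3) by auto
    ultimately show ?thesis using split[of M] a b vertical[OF 2(1), of a] by linarith
  next
    case (3 \<nu> \<mu>)
    have "(1, x, y) \<notin> M" for x y
    proof
      assume "(1, x, y) \<in> M"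
      then have "1 = \<nu> * x + \<mu> * y" using 3 by auto
      then show False using one_notin_N N_add N_mult_right 3(1,2) by metis
    qed
    then have a: "card {(x, y) \<in> A. (1, x, y) \<in> M} \<le> 0" by (intro empty)
    have "card {(n, y) \<in> B. (n, 1, y) \<in> M} \<le> card {(n, y) \<in> B. n = \<nu> + \<mu> * y}"
      using 3 by (intro card_mono) auto
    also have "\<dots> \<le> q * card I"
      unfolding B_def by (rule infinite_segments_line_at_infinity[OF I(1)])
    finally have b: "card {(n, y) \<in> B. (n, 1, y) \<in> M} \<le> q * card I" .
    have "x = \<mu>" if "(x, y) \<in> C" "(x, y, 1) \<in> M" for x y
    proof -
      have "x = \<nu> * y + \<mu>" using that 3 by auto
      moreover have "\<nu> * y = 0" using that C 3(1) by (intro N_mult_N) auto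
      ultimately show ?thesis by simp
    qed
    then have "card {(n, m) \<in> C. (n, m, 1) \<in> M} \<le> card {(x, y) \<in> C. x = \<mu>}"
      by (intro card_mono) auto
    then show ?thesis using split[of M] a b infinite[of \<mu>] by linarith
  qed
  have "proj_arc (cyclic_submodule ` V) (card V) n"
    using normal lines by (rule proj_arc_cyclic_submodules)
  then show ?thesis unfolding cardV by blast
qed

section \<open>Point sets in the vertical infinite class\<close>

lemma card_product_vertical: "card {(x, y) \<in> Y \<times> Z. y = a * x + \<nu>} \<le> card (Y :: 'r set)"
  by (rule card_inj_on_le[of fst]) (auto simp: inj_on_def)

lemma card_product_infinite: "card {(x, y) \<in> Y \<times> Z. x = \<mu>} \<le> card (Z :: 'r set)"
  by (rule card_inj_on_le[of snd]) (auto simp: inj_on_def)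

text \<open>A union of parallel segments of slope \<open>\<xi>\<close>, one for each element of
  \<open>Y\<close>. A vertical line contains a whole segment only if \<open>rep a = \<xi>\<close>;
  when the column \<open>\<xi>\<close> is empty, such a line has no affine points and can afford
  this.\<close>

definition skew_grid :: "'r \<Rightarrow> 'r set \<Rightarrow> ('r \<times> 'r) set" where
  "skew_grid \<xi> Y = {(x, y) \<in> N \<times> N. y - \<xi> * x \<in> Y}"

lemma card_skew_grid:
  assumes "Y \<subseteq> N" shows "card (skew_grid \<xi> Y) = q * card Y"
proof -
  have "bij_betw (\<lambda>(x, y). (x, y - \<xi> * x)) (skew_grid \<xi> Y) (N \<times> Y)"
    by (rule bij_betw_byWitness[of _ "\<lambda>(x, y). (x, y + \<xi> * x)"])
       (use assms N_add N_mult_left in \<open>auto simp: skew_grid_def\<close>)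
  then show ?thesis by (simp add: bij_betw_same_card card_cartesian_product card_N)
qed

lemma card_skew_grid_vertical:
  assumes "\<xi> \<in> range rep"
  shows "card {(x, y) \<in> skew_grid \<xi> Y. y = a * x + \<nu>} \<le> (if rep a = \<xi> then q else card Y)"
proof (cases "rep a = \<xi>")
  case True
  have "card {(x, y) \<in> skew_grid \<xi> Y. y = a * x + \<nu>} \<le> card N"
    by (rule card_inj_on_le[of fst]) (auto simp: inj_on_def skew_grid_def)
  then show ?thesis using True by (simp add: card_N)
next
  case False
  have "a - \<xi> \<notin> N" using False assms by (metis rep_eq_iff rep_range)
  then have inj: "x = x'" if "a * x - \<xi> * x = a * x' - \<xi> * x'" for x x'
    using that annihilator_left[of "x - x'" "a - \<xi>"] by (auto simp: algebra_simps)
  have "card {(x, y) \<in> skew_grid \<xi> Y. y = a * x + \<nu>} \<le> card Y"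
  proof (rule card_inj_on_le)
    show "inj_on (\<lambda>(x, y). y - \<xi> * x) {(x, y) \<in> skew_grid \<xi> Y. y = a * x + \<nu>}"
    proof (rule inj_onI)
      fix p p' assume p: "p \<in> {(x, y) \<in> skew_grid \<xi> Y. y = a * x + \<nu>}"
        "p' \<in> {(x, y) \<in> skew_grid \<xi> Y. y = a * x + \<nu>}"
        "(case p of (x, y) \<Rightarrow> y - \<xi> * x) = (case p' of (x, y) \<Rightarrow> y - \<xi> * x)"
      then obtain x x' where x: "p = (x, a * x + \<nu>)" "p' = (x', a * x' + \<nu>)" by auto
      then have "a * x - \<xi> * x = a * x' - \<xi> * x'" using p(3) by (simp add: algebra_simps)
      then show "p = p'" using x inj by blast
    qed
  qed (auto simp: skew_grid_def)
  then show ?thesis using False by simp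
qed

lemma card_skew_grid_infinite: "card {(x, y) \<in> skew_grid \<xi> Y. x = \<mu>} \<le> card Y"
  by (rule card_inj_on_le[of "\<lambda>(x, y). y - \<xi> * x"]) (auto simp: inj_on_def skew_grid_def)

section \<open>Choice of the parameters\<close>

lemma obtain_N_subset:
  assumes "k \<le> q" obtains Y where "Y \<subseteq> N" "card Y = k"
  using obtain_subset_with_card_n[of k N] assms card_N by auto

lemma obtain_rep_subset:
  assumes "k \<le> q" obtains J where "J \<subseteq> range rep" "card J = k"
  using obtain_subset_with_card_n[of k "range rep"] assms card_range_rep by auto

lemma card_rep_complement: "J \<subseteq> range rep \<Longrightarrow> card (range rep - J) = q - card J"
  by (simp add: card_Diff_subset card_range_rep)

text \<open>The columns use \<open>2 * card J2 + card J1 = q + t + 2\<close>, so \<open>J1\<close>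
  only absorbs the parity. The bound on \<open>t\<close> leaves two columns outside
  \<open>J2\<close> to serve as \<open>I\<close>, and at least one column \<open>\<xi>\<close>
  entirely empty, which allows a skew grid of \<open>q * t\<close> points. Two slopes in
  \<open>I\<close> cost a line near infinity \<open>2 * q\<close> points, leaving \<open>t\<close>
  for the grid.\<close>

lemma m_arc_small:
  assumes "t + 5 \<le> q"
  shows "q\<^sup>2 * (q + t + 2) + (q - 2) * (2 * q) + q * t \<le> m_arc TYPE('r) (2 * q + t)"
proof -
  let ?m = "q + t + 2"
  have "?m div 2 \<le> q" using assms by linarith
  then obtain J2 where J2: "J2 \<subseteq> range rep" "card J2 = ?m div 2" by (rule obtain_rep_subset)
  have rest: "card (range rep - J2) \<ge> 2"
    using card_rep_complement[OF J2(1)] J2(2) assms by linarith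
  obtain I where I: "I \<subseteq> range rep - J2" "card I = 2"
    using obtain_subset_with_card_n[OF rest] by auto
  obtain J1 where J1: "J1 \<subseteq> range rep - J2" "card J1 = ?m mod 2"
    using obtain_subset_with_card_n[of "?m mod 2" "range rep - J2"] rest
    by (metis le_trans mod_less_divisor less_imp_le zero_less_numeral)
  \<comment> \<open>\<open>J1\<close> has at most one element, while at least two columns are
    available.\<close>
  have "J1 \<noteq> range rep - J2" using J1(2) rest by (metis mod_less_divisor not_le zero_less_numeral)
  then obtain \<xi> where \<xi>: "\<xi> \<in> range rep" "\<xi> \<notin> J1 \<union> J2" using J1(1) by blast
  obtain W where W: "W \<subseteq> N" "card W = q - 2" using obtain_N_subset[of "q - 2"] by auto
  obtain Y where Y: "Y \<subseteq> N" "card Y = t" using obtain_N_subset[of t] assms by auto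
  have "\<exists>K :: 'r vec3 set set. proj_arc K
    (2 * q\<^sup>2 * card J2 + q\<^sup>2 * card J1 + card W * (card I * q) + card (skew_grid \<xi> Y)) (2 * q + t)"
  proof (rule proj_arc_construction)
    show "J1 \<subseteq> range rep" "J2 \<subseteq> range rep" "J1 \<inter> J2 = {}" "I \<subseteq> range rep" "I \<inter> J2 = {}"
      using J1 J2 I by auto
    show "W \<subseteq> N" "card W \<le> q - 2" using W by auto
    show "skew_grid \<xi> Y \<subseteq> N \<times> N" by (auto simp: skew_grid_def)
    show "2 * card J2 + card J1 + (q - 2) \<le> 2 * q + t" using J1(2) J2(2) assms by simp
    show "card {(x, y) \<in> skew_grid \<xi> Y. y = a * x + \<nu>} + (if rep a \<in> J1 \<union> J2 then 2 * q else 0)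
        \<le> 2 * q + t" for a \<nu>
    proof -
      have "(if rep a = \<xi> then q else card Y) + (if rep a \<in> J1 \<union> J2 then 2 * q else 0) \<le> 2 * q + t"
        using \<xi>(2) Y(2) by auto
      then show ?thesis using card_skew_grid_vertical[OF \<xi>(1), of Y a \<nu>] by linarith
    qed
    show "card {(x, y) \<in> skew_grid \<xi> Y. x = \<mu>} + q * card I \<le> 2 * q + t" for \<mu>
      using card_skew_grid_infinite[of \<xi> Y \<mu>] Y(2) unfolding I(2) by linarith
  qed
  moreover have "2 * q\<^sup>2 * card J2 + q\<^sup>2 * card J1 = q\<^sup>2 * (2 * card J2 + card J1)"
    by (simp add: algebra_simps)
  moreover have "2 * card J2 + card J1 = ?m" unfolding J1(2) J2(2) by simp
  ultimately have "\<exists>K :: 'r vec3 set set. proj_arc K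
      (q\<^sup>2 * ?m + (q - 2) * (2 * q) + q * t) (2 * q + t)"
    using W I Y by (simp add: card_skew_grid)
  then show ?thesis using le_m_arc by blast
qed

text \<open>Every column is occupied, conic unless double, so each vertical line is allotted
  \<open>2 * q\<close> affine points and only \<open>t\<close> remain for it. A product set with
  \<open>t\<close> first coordinates respects this; its \<open>r\<close> second coordinates share
  the budget of the lines near infinity with the \<open>i\<close> slopes.\<close>

lemma m_arc_large:
  assumes j: "j \<le> q" "j = t + 2" and i: "i + j \<le> q" and r: "r \<le> q" "r + q * i \<le> 2 * q + t"
  shows "q\<^sup>2 * (q + j) + (q - 2) * (i * q) + t * r \<le> m_arc TYPE('r) (2 * q + t)"
proof -
  obtain J2 where J2: "J2 \<subseteq> range rep" "card J2 = j" using obtain_rep_subset[OF j(1)] by auto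
  let ?J1 = "range rep - J2"
  have J1: "card ?J1 = q - j" using card_rep_complement[OF J2(1)] J2(2) by simp
  have "i \<le> card ?J1" using J1 i by simp
  then obtain I where I: "I \<subseteq> ?J1" "card I = i" by (rule obtain_subset_with_card_n)
  obtain W where W: "W \<subseteq> N" "card W = q - 2" using obtain_N_subset[of "q - 2"] by auto
  obtain Y where Y: "Y \<subseteq> N" "card Y = t" using obtain_N_subset[of t] j by auto
  obtain Z where Z: "Z \<subseteq> N" "card Z = r" using obtain_N_subset[OF r(1)] by auto
  have "\<exists>K :: 'r vec3 set set. proj_arc K
    (2 * q\<^sup>2 * card J2 + q\<^sup>2 * card ?J1 + card W * (card I * q) + card (Y \<times> Z)) (2 * q + t)"
  proof (rule proj_arc_construction)
    show "?J1 \<subseteq> range rep" "J2 \<subseteq> range rep" "?J1 \<inter> J2 = {}" "I \<subseteq> range rep" "I \<inter> J2 = {}"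
      using J2 I by auto
    show "W \<subseteq> N" "card W \<le> q - 2" using W by auto
    show "Y \<times> Z \<subseteq> N \<times> N" using Y Z by auto
    show "2 * card J2 + card ?J1 + (q - 2) \<le> 2 * q + t" using J1 J2(2) j q_ge_2 by simp
    show "card {(x, y) \<in> Y \<times> Z. y = a * x + \<nu>} + (if rep a \<in> ?J1 \<union> J2 then 2 * q else 0)
        \<le> 2 * q + t" for a \<nu>
      using card_product_vertical[of Y Z a \<nu>] Y(2) by (simp split: if_splits)
    show "card {(x, y) \<in> Y \<times> Z. x = \<mu>} + q * card I \<le> 2 * q + t" for \<mu>
      using card_product_infinite[of Y Z \<mu>] Z(2) r(2) unfolding I(2) by linarith
  qed
  moreover have "2 * q\<^sup>2 * card J2 + q\<^sup>2 * card ?J1 = q\<^sup>2 * (2 * card J2 + card ?J1)"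
    by (simp add: algebra_simps)
  moreover have "2 * card J2 + card ?J1 = q + j" using J1 J2(2) j by simp
  ultimately have "\<exists>K :: 'r vec3 set set. proj_arc K
      (q\<^sup>2 * (q + j) + (q - 2) * (i * q) + t * r) (2 * q + t)"
    using W I Y Z by (simp add: card_cartesian_product)
  then show ?thesis using le_m_arc by blast
qed

end

theorem theorem3p3:
  fixes N :: "'r::{ring_1,finite} set" and q t n :: nat
  assumes "chain_ring2 N"
    and "card (UNIV :: 'r set) = q * card N"
    and "n = 2 * q + t"
    and "int t \<le> int q - 2"
  shows "int (m_arc TYPE('r) n) \<ge>
    (if int t \<le> int q - 5 then int q * (int q + 1) * int n - int q ^ 3 + 2 * int q ^ 2 - 4 * int q - 2 * int t
     else if int t = int q - 4 then int q * (int q + 1) * int n - int q ^ 3 + 2 * int q ^ 2 - 8 * int q + 16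
     else if int t = int q - 3 then int q * (int q + 1) * int n - int q ^ 3 + int q ^ 2 - 2 * int q
     else int q * (int q + 1) * int n - int q ^ 3)"
proof -
  interpret chain_ring N q by unfold_locales (use assms in auto)
  note powers = power2_eq_square power3_eq_cube
  consider "t + 5 \<le> q" | "q = t + 4" | "q = t + 3" | "q = t + 2" using assms(4) by linarith
  then show ?thesis
  proof cases
    case 1
    \<comment> \<open>Parametrizing \<open>q\<close> as a sum removes the truncated subtraction
      \<open>q - 2\<close>.\<close>
    then obtain d where d: "q = t + 5 + d" by (auto simp: le_iff_add)
    from m_arc_small[OF 1]
    have "int (q\<^sup>2 * (q + t + 2) + (q - 2) * (2 * q) + q * t) \<le> int (m_arc TYPE('r) n)"
      unfolding assms(3) by (simp only: of_nat_le_iff)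
    \<comment> \<open>The size obtained exceeds the required bound by \<open>2 * t\<close>.\<close>
    moreover have "int (q\<^sup>2 * (q + t + 2) + (q - 2) * (2 * q) + q * t) =
      int q * (int q + 1) * int n - int q ^ 3 + 2 * int q ^ 2 - 4 * int q"
      unfolding assms(3) d by (simp add: powers algebra_simps)
    ultimately show ?thesis using 1 by simp
  next
    case 2
    \<comment> \<open>Here \<open>j = q - 2\<close> and \<open>i = 2\<close>; the slopes already
      cost \<open>2 * q\<close> at infinity, so \<open>r = t\<close>.\<close>
    have "q\<^sup>2 * (q + (q - 2)) + (q - 2) * (2 * q) + t * t \<le> m_arc TYPE('r) n"
      unfolding assms(3) by (rule m_arc_large) (use 2 in auto)
    then have "int (q\<^sup>2 * (q + (q - 2)) + (q - 2) * (2 * q) + t * t) \<le> int (m_arc TYPE('r) n)"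
      by (simp only: of_nat_le_iff)
    moreover have "int (q\<^sup>2 * (q + (q - 2)) + (q - 2) * (2 * q) + t * t) =
      int q * (int q + 1) * int n - int q ^ 3 + 2 * int q ^ 2 - 8 * int q + 16"
      unfolding assms(3) 2 by (simp add: powers algebra_simps)
    ultimately show ?thesis using 2 by simp
  next
    case 3
    \<comment> \<open>Here \<open>j = q - 1\<close> leaves room for \<open>i = 1\<close> slope only,
      and the budget at infinity then admits \<open>r = q\<close>.\<close>
    have "q\<^sup>2 * (q + (q - 1)) + (q - 2) * (1 * q) + t * q \<le> m_arc TYPE('r) n"
      unfolding assms(3) by (rule m_arc_large) (use 3 in auto)
    then have "int (q\<^sup>2 * (q + (q - 1)) + (q - 2) * (1 * q) + t * q) \<le> int (m_arc TYPE('r) n)"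
      by (simp only: of_nat_le_iff)
    moreover have "int (q\<^sup>2 * (q + (q - 1)) + (q - 2) * (1 * q) + t * q) =
      int q * (int q + 1) * int n - int q ^ 3 + int q ^ 2 - 2 * int q"
      unfolding assms(3) 3 by (simp add: powers algebra_simps)
    ultimately show ?thesis using 3 by simp
  next
    case 4
    \<comment> \<open>All columns are double, \<open>j = q\<close>, so no slope is left for infinite
      segments: \<open>i = 0\<close> and \<open>r = q\<close>.\<close>
    have "q\<^sup>2 * (q + q) + (q - 2) * (0 * q) + t * q \<le> m_arc TYPE('r) n"
      unfolding assms(3) by (rule m_arc_large) (use 4 in auto)
    then have "int (q\<^sup>2 * (q + q) + (q - 2) * (0 * q) + t * q) \<le> int (m_arc TYPE('r) n)"
      by (simp only: of_nat_le_iff)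
    moreover have "int (q\<^sup>2 * (q + q) + (q - 2) * (0 * q) + t * q) =
      int q * (int q + 1) * int n - int q ^ 3"
      unfolding assms(3) 4 by (simp add: powers algebra_simps)
    ultimately show ?thesis using 4 by simp
  qed
qed

end
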